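(* Assume the leakage condition and that $R_0$ is trace class. For each $\omega\in\Omega$ and $k\ge1$, let $\{u_{k,r}(\omega)\}_{r\in\mathcal R_k(\omega)}$ be an (at most countable) orthonormal family and $\lambda_{k,r}(\omega)\ge0$ with $\Delta_k(\omega)=\sum_r\lambda_{k,r}(\omega)\langle\cdot,u_{k,r}(\omega)\rangle u_{k,r}(\omega)$ in the strong operator topology, and set $\varphi_{k,r}(\omega)=\lambda_{k,r}(\omega)^{1/2}u_{k,r}(\omega)$. Then there is a set $\Omega_0\subseteq\Omega$ with $\nu^{\mathrm{tr}}(\Omega_0)=1$ such that for every $\omega\in\Omega_0$: (1) $R_0=\sum_{k=1}^\infty\Delta_k(\omega)$ in the strong operator topology; (2) for every $x\in H$, $\langle x,R_0x\rangle=\sum_{k=1}^\infty\langle x,\Delta_k(\omega)x\rangle=\sum_{k=1}^\infty\sum_{r\in\mathcal R_k(\omega)}|\langle x,\varphi_{k,r}(\omega)\rangle|^2$, with monotone convergence; (3) the family $\{\varphi_{k,r}(\omega):k\ge1,r\in\mathcal R_k(\omega)\}$ has closed linear span equal to $\overline{\mathrm{ran}}(R_0^{1/2})$ and satisfies $\sum_{k,r}|\langle x,\varphi_{k,r}(\omega)\rangle|^2=\langle x,R_0x\rangle$ for all $x\in H$ (a frame for $\overline{\mathrm{ran}}(R_0^{1/2})$ with frame operator $R_0$). In particular, if $R_0$ is the orthogonal projection onto a closed subspace $K\subseteq H$, then $\{\varphi_{k,r}(\omega)\}$ is a Parseval frame for $K$.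
   Context: Let $H$ be a separable complex Hilbert space, $m\ge2$, $P_1,\dots,P_m$ orthogonal projections on $H$, $R_0\in B(H)_+$, and $H_0=\overline{\mathrm{ran}}(R_0^{1/2})$. Let $\mathcal A=\{1,\dots,m\}$, $\mathcal W$ the set of finite words over $\mathcal A$ (including the empty word $\emptyset$); for nonempty $w=j_1\cdots j_n$, $w^-=j_1\cdots j_{n-1}$, and $wj$ is concatenation. WR energy tree: $R_\emptyset=R_0$, and for $w=j_1\cdots j_n$, $n\ge1$, $R_w=R_{w^-}^{1/2}(I-P_{j_n})R_{w^-}^{1/2}$, $D_w=R_{w^-}^{1/2}P_{j_n}R_{w^-}^{1/2}$. $\Omega=\mathcal A^{\mathbb N}$; for $\omega=(j_1,j_2,\dots)$, $\omega|_n=j_1\cdots j_n$, $\omega|_0=\emptyset$; cylinders $[w]=\{\omega:\omega|_{|w|}=w\}$. $\Delta_k(\omega)=D_{\omega|_k}=R_{\omega|_{k-1}}^{1/2}P_{j_k}R_{\omega|_{k-1}}^{1/2}$. Leakage condition: there is $\alpha>0$ with $\langle v,(\sum_{j=1}^mP_j)v\rangle\ge\alpha\|v\|^2$ for all $v\in H_0$. Trace-biased path measure (when $R_0$ is trace class, so every $R_w$, $D_{wj}$ is trace class): $s^{\mathrm{tr}}_{wj}=\mathrm{tr}(D_{wj})$, $S^{\mathrm{tr}}_w=\sum_js^{\mathrm{tr}}_{wj}$; fix $q\in(0,1)^m$ with $\sum_jq_j=1$; $p^{\mathrm{tr}}(j\mid w)=s^{\mathrm{tr}}_{wj}/S^{\mathrm{tr}}_w$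 if $S^{\mathrm{tr}}_w>0$ and $p^{\mathrm{tr}}(j\mid w)=q_j$ otherwise; $\nu^{\mathrm{tr}}$ is the unique Borel probability measure on $\Omega$ with $\nu^{\mathrm{tr}}([j_1\cdots j_n])=\prod_{i=1}^np^{\mathrm{tr}}(j_i\mid j_1\cdots j_{i-1})$. *)

theory Defs
  imports "HOL-Analysis.Analysis" "HOL-Probability.Probability"
begin

class complex_vector = real_vector +
  fixes scaleC :: "complex \<Rightarrow> 'a \<Rightarrow> 'a" (infixr \<open>*\<^sub>C\<close> 75)
  assumes scaleC_add_right: "a *\<^sub>C (x + y) = a *\<^sub>C x + a *\<^sub>C y"
    and scaleC_add_left: "(a + b) *\<^sub>C x = a *\<^sub>C x + b *\<^sub>C x"
    and scaleC_scaleC: "a *\<^sub>C (b *\<^sub>C x) = (a * b) *\<^sub>C x"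
    and scaleC_one: "1 *\<^sub>C x = x"
    and scaleR_scaleC: "scaleR r x = complex_of_real r *\<^sub>C x"

class complex_inner = complex_vector + real_normed_vector +
  fixes cinner :: "'a \<Rightarrow> 'a \<Rightarrow> complex"
  assumes cinner_commute: "cinner x y = cnj (cinner y x)"
    and cinner_add_left: "cinner (x + y) z = cinner x z + cinner y z"
    and cinner_scaleC_left: "cinner (c *\<^sub>C x) y = cnj c * cinner x y"
    and cinner_ge_zero: "Im (cinner x x) = 0 \<and> 0 \<le> Re (cinner x x)"
    and cinner_eq_zero_iff: "cinner x x = 0 \<longleftrightarrow> x = 0"
    and norm_eq_sqrt_cinner: "norm x = sqrt (Re (cinner x x))"

class chilbert_space = complex_inner + complete_space

definition bounded_clinear :: "('a::complex_inner \<Rightarrow> 'a) \<Rightarrow> bool" where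
  "bounded_clinear A \<longleftrightarrow> bounded_linear A \<and> (\<forall>c x. A (c *\<^sub>C x) = c *\<^sub>C A x)"

definition positive_op :: "('a::complex_inner \<Rightarrow> 'a) \<Rightarrow> bool" where
  "positive_op A \<longleftrightarrow> bounded_clinear A \<and>
     (\<forall>x. Im (cinner x (A x)) = 0 \<and> 0 \<le> Re (cinner x (A x)))"

definition orth_proj :: "('a::complex_inner \<Rightarrow> 'a) \<Rightarrow> bool" where
  "orth_proj P \<longleftrightarrow> bounded_clinear P \<and> (\<forall>x. P (P x) = P x) \<and>
     (\<forall>x y. cinner (P x) y = cinner x (P y))"

definition op_sqrt :: "('a::complex_inner \<Rightarrow> 'a) \<Rightarrow> ('a \<Rightarrow> 'a)" where
  "op_sqrt A = (THE B. positive_op B \<and> B \<circ> B = A)"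

definition cspan :: "'a::complex_vector set \<Rightarrow> 'a set" where
  "cspan S = {x. \<exists>F c. finite F \<and> F \<subseteq> S \<and> x = (\<Sum>v\<in>F. c v *\<^sub>C v)}"

definition orthonormal :: "'a::complex_inner set \<Rightarrow> bool" where
  "orthonormal B \<longleftrightarrow> (\<forall>e\<in>B. norm e = 1) \<and> (\<forall>e\<in>B. \<forall>f\<in>B. e \<noteq> f \<longrightarrow> cinner e f = 0)"

definition is_onb :: "'a::complex_inner set \<Rightarrow> bool" where
  "is_onb B \<longleftrightarrow> orthonormal B \<and> closure (cspan B) = UNIV"

text \<open>Trace class and trace for positive operators (for positive A, \<open>|A| = A\<close>):
  \<open>tr A = \<Sum>\<^sub>e \<langle>e, A e\<rangle>\<close> over an orthonormal basis (basis independent for positive A).\<close>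
definition trace_class_pos :: "('a::complex_inner \<Rightarrow> 'a) \<Rightarrow> bool" where
  "trace_class_pos A \<longleftrightarrow> positive_op A \<and>
     (\<exists>B. is_onb B \<and> (\<lambda>e. Re (cinner e (A e))) summable_on B)"

definition trace_pos :: "('a::complex_inner \<Rightarrow> 'a) \<Rightarrow> real" where
  "trace_pos A = infsum (\<lambda>e. Re (cinner e (A e))) (SOME B. is_onb B)"

text \<open>Words are lists over \<open>{1..m}\<close>; \<open>Rrev\<close> works on the reversed word, so that
  \<open>Rrev (j # rev w) = R_{wj}\<close>.\<close>
fun Rrev :: "('a::complex_inner \<Rightarrow> 'a) \<Rightarrow> (nat \<Rightarrow> 'a \<Rightarrow> 'a) \<Rightarrow> nat list \<Rightarrow> ('a \<Rightarrow> 'a)" where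
  "Rrev R0 P [] = R0"
| "Rrev R0 P (j # ws) = op_sqrt (Rrev R0 P ws) \<circ> (\<lambda>x. x - P j x) \<circ> op_sqrt (Rrev R0 P ws)"

definition Rw :: "('a::complex_inner \<Rightarrow> 'a) \<Rightarrow> (nat \<Rightarrow> 'a \<Rightarrow> 'a) \<Rightarrow> nat list \<Rightarrow> ('a \<Rightarrow> 'a)" where
  "Rw R0 P w = Rrev R0 P (rev w)"

definition Dw :: "('a::complex_inner \<Rightarrow> 'a) \<Rightarrow> (nat \<Rightarrow> 'a \<Rightarrow> 'a) \<Rightarrow> nat list \<Rightarrow> nat \<Rightarrow> ('a \<Rightarrow> 'a)" where
  "Dw R0 P w j = op_sqrt (Rw R0 P w) \<circ> P j \<circ> op_sqrt (Rw R0 P w)"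

text \<open>Paths \<open>\<omega> = (j_1, j_2, \<dots>)\<close> are functions \<open>nat \<Rightarrow> nat\<close> with \<open>j_i = \<omega> (i - 1)\<close>;
  \<open>\<omega>|_n = prefix \<omega> n\<close>.\<close>
definition prefix :: "(nat \<Rightarrow> nat) \<Rightarrow> nat \<Rightarrow> nat list" where
  "prefix \<omega> n = map \<omega> [0..<n]"

text \<open>\<open>\<Delta>_k(\<omega>) = D_{\<omega>|_k}\<close> for \<open>k \<ge> 1\<close>.\<close>
definition Delta :: "('a::complex_inner \<Rightarrow> 'a) \<Rightarrow> (nat \<Rightarrow> 'a \<Rightarrow> 'a) \<Rightarrow> (nat \<Rightarrow> nat) \<Rightarrow> nat \<Rightarrow> ('a \<Rightarrow> 'a)" where
  "Delta R0 P \<omega> k = Dw R0 P (prefix \<omega> (k - 1)) (\<omega> (k - 1))"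

definition Omega_space :: "nat \<Rightarrow> (nat \<Rightarrow> nat) measure" where
  "Omega_space m = PiM UNIV (\<lambda>_. count_space {1..m})"

definition cylinder :: "nat \<Rightarrow> nat list \<Rightarrow> (nat \<Rightarrow> nat) set" where
  "cylinder m w = {\<omega> \<in> space (Omega_space m). prefix \<omega> (length w) = w}"

definition p_tr :: "nat \<Rightarrow> (nat \<Rightarrow> real) \<Rightarrow> ('a::complex_inner \<Rightarrow> 'a) \<Rightarrow> (nat \<Rightarrow> 'a \<Rightarrow> 'a)
    \<Rightarrow> nat list \<Rightarrow> nat \<Rightarrow> real" where
  "p_tr m qs R0 P w j =
     (let S = (\<Sum>i\<in>{1..m}. trace_pos (Dw R0 P w i))
      in if S > 0 then trace_pos (Dw R0 P w j) / S else qs j)"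

definition is_nu_tr :: "nat \<Rightarrow> (nat \<Rightarrow> real) \<Rightarrow> ('a::complex_inner \<Rightarrow> 'a) \<Rightarrow> (nat \<Rightarrow> 'a \<Rightarrow> 'a)
    \<Rightarrow> (nat \<Rightarrow> nat) measure \<Rightarrow> bool" where
  "is_nu_tr m qs R0 P \<nu> \<longleftrightarrow> prob_space \<nu> \<and> sets \<nu> = sets (Omega_space m) \<and>
     (\<forall>w. set w \<subseteq> {1..m} \<longrightarrow>
        measure \<nu> (cylinder m w) = (\<Prod>i<length w. p_tr m qs R0 P (take i w) (w ! i)))"

end

theory Submission
  imports Defs
begin

text \<open>
  Telescoping \<open>R\<^sub>w = D\<^sub>w\<^sub>j + R\<^sub>w\<^sub>j\<close> along a path gives \<open>R\<^sub>0 = \<Sum>\<^sub>k\<^sub>\<le>\<^sub>n \<Delta>\<^sub>k + R\<^sub>n\<close>, so everything rests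
  on \<open>R\<^sub>n \<rightarrow> 0\<close>. The range of each \<open>R\<^sub>w\<^sup>1\<^sup>/\<^sup>2\<close> stays in the closure of the range of \<open>R\<^sub>0\<^sup>1\<^sup>/\<^sup>2\<close>, so leakage gives
  \<open>\<Sum>\<^sub>j tr D\<^sub>w\<^sub>j \<ge> \<alpha> tr R\<^sub>w\<close>, and one step of the trace-biased path multiplies the expected trace by at most
  \<open>1 - \<alpha>/m\<close>. Hence \<open>\<Sum>\<^sub>n tr R\<^sub>n\<close> has finite expectation and \<open>tr R\<^sub>n \<rightarrow> 0\<close> almost surely. For operators
  \<open>0 \<le> B \<le> A\<close> one has \<open>\<parallel>B x\<parallel>\<^sup>2 \<le> \<parallel>A\<parallel> \<langle>x, B x\<rangle>\<close>; this upgrades convergence of quadratic forms to strong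
  convergence, both for \<open>R\<^sub>n\<close> and for the unconditional frame expansion of \<open>R\<^sub>0\<close>.
\<close>

section \<open>Complex inner product spaces\<close>

instance chilbert_space \<subseteq> banach ..

lemma cinner_add_right: "cinner x (y + z) = cinner x y + cinner x z"
  by (metis cinner_add_left cinner_commute complex_cnj_add)

lemma cinner_scaleC_right: "cinner x (c *\<^sub>C y) = c * cinner x y"
  by (metis cinner_commute cinner_scaleC_left complex_cnj_cnj complex_cnj_mult)

lemma cinner_self: "cinner x x = complex_of_real ((norm x)\<^sup>2)"
  by (simp add: norm_eq_sqrt_cinner cinner_ge_zero complex_eq_iff)

lemma Re_cinner_self: "Re (cinner x x) = (norm x)\<^sup>2"
  by (simp add: cinner_self)

lemma Re_cinner_commute: "Re (cinner x y) = Re (cinner y x)"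
  by (metis cinner_commute cnj.sel(1))

lemma norm_add_squared: "(norm (x + y))\<^sup>2 = (norm x)\<^sup>2 + 2 * Re (cinner x y) + (norm y)\<^sup>2"
  unfolding Re_cinner_self[symmetric]
  by (simp add: cinner_add_left cinner_add_right Re_cinner_commute[of y x])

lemma norm_scaleC:
  fixes x :: "'a::complex_inner"
  shows "norm (c *\<^sub>C x) = cmod c * norm x"
proof -
  have "complex_of_real ((norm (c *\<^sub>C x))\<^sup>2) = (c * cnj c) * cinner x x"
    by (simp only: cinner_self[symmetric] cinner_scaleC_left cinner_scaleC_right mult_ac)
  also have "\<dots> = complex_of_real ((cmod c * norm x)\<^sup>2)"
    by (simp only: complex_norm_square[symmetric] cinner_self power_mult_distrib of_real_mult)
  finally show ?thesis
    by (simp only: of_real_eq_iff power2_eq_iff_nonneg norm_ge_zero mult_nonneg_nonneg)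
qed

text \<open>Expands the nonnegative quantity \<open>(norm (x + c *\<^sub>C y))\<^sup>2\<close> at
  its minimising \<open>c\<close>.\<close>

lemma cinner_Cauchy_Schwarz: "cmod (cinner x y) \<le> norm x * norm y"
proof (cases "y = 0")
  case True
  have "cinner x (0::'a) = 0"
    using cinner_add_right[of x 0 0] by simp
  with True show ?thesis by simp
next
  case False
  \<comment> \<open>The coefficient for which \<open>x + c *\<^sub>C y\<close> is orthogonal to
    \<open>y\<close>; the conjugate appears because \<open>cinner\<close> is conjugate-linear in its
    first argument.\<close>
  define c where "c = - (cnj (cinner x y) / complex_of_real ((norm y)\<^sup>2))"
  have pos: "(norm y)\<^sup>2 > 0" using False by simp
  have cxy: "c * cinner x y = complex_of_real (- ((cmod (cinner x y))\<^sup>2 / (norm y)\<^sup>2))"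
    unfolding c_def by (simp add: complex_norm_square[symmetric] mult.commute del: of_real_power)
  have nc: "cmod c = cmod (cinner x y) / (norm y)\<^sup>2"
    unfolding c_def by (simp add: norm_divide norm_power)
  have "0 \<le> (norm (x + c *\<^sub>C y))\<^sup>2" by simp
  also have "\<dots> = (norm x)\<^sup>2 - 2 * ((cmod (cinner x y))\<^sup>2 / (norm y)\<^sup>2) + (cmod c * norm y)\<^sup>2"
    unfolding norm_add_squared norm_scaleC cinner_scaleC_right cxy by simp
  also have "\<dots> = (norm x)\<^sup>2 - (cmod (cinner x y))\<^sup>2 / (norm y)\<^sup>2"
    unfolding nc using pos by (simp add: power2_eq_square field_simps)
  finally have "(cmod (cinner x y))\<^sup>2 \<le> (norm x * norm y)\<^sup>2"
    using pos by (simp add: field_simps power_mult_distrib)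
  then show ?thesis by (simp add: power2_le_iff_abs_le abs_mult)
qed

text \<open>Over the reals a sesquilinear form is bilinear, so the rules for limits, finite sums,
  differences and real scaling become available as \<open>cinner.*\<close>.\<close>

interpretation cinner: bounded_bilinear "cinner :: 'a::complex_inner \<Rightarrow> 'a \<Rightarrow> complex"
proof
  show "\<exists>K. \<forall>x y :: 'a. cmod (cinner x y) \<le> norm x * norm y * K"
    by (rule exI[of _ 1]) (simp add: cinner_Cauchy_Schwarz)
qed (simp_all add: cinner_add_left cinner_add_right scaleR_scaleC cinner_scaleC_left
    cinner_scaleC_right scaleR_conv_of_real)

lemma bounded_linear_scaleC: "bounded_linear (\<lambda>x::'a::complex_inner. c *\<^sub>C x)"
proof (rule bounded_linear_intro)
  show "norm (c *\<^sub>C x) \<le> norm x * cmod c" for x :: 'a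
    by (simp add: norm_scaleC)
qed (simp_all add: scaleC_add_right scaleR_scaleC scaleC_scaleC mult.commute)

lemma norm_diff_squared: "(norm (x - y))\<^sup>2 = (norm x)\<^sup>2 - 2 * Re (cinner x y) + (norm y)\<^sup>2"
  using norm_add_squared[of x "- y"] by (simp add: cinner.minus_right)

section \<open>Positive operators\<close>

lemma positive_op_bounded_linear: "positive_op A \<Longrightarrow> bounded_linear A"
  by (simp add: positive_op_def bounded_clinear_def)

lemma positive_op_scaleC: "positive_op A \<Longrightarrow> A (c *\<^sub>C x) = c *\<^sub>C A x"
  by (simp add: positive_op_def bounded_clinear_def)

lemma positive_op_nonneg: "positive_op A \<Longrightarrow> 0 \<le> Re (cinner x (A x))"
  by (simp add: positive_op_def)

lemma positive_op_real: "positive_op A \<Longrightarrow> cinner x (A x) = complex_of_real (Re (cinner x (A x)))"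
  by (simp add: positive_op_def complex_eq_iff)

text \<open>Symmetry makes the form equal to its own conjugate, which supplies the reality condition
  in \<open>positive_op\<close>.\<close>

lemma positive_opI:
  assumes "bounded_linear A" "\<And>c x. A (c *\<^sub>C x) = c *\<^sub>C A x"
    and "\<And>x y. cinner (A x) y = cinner x (A y)" "\<And>x. 0 \<le> Re (cinner x (A x))"
  shows "positive_op A"
proof -
  have "Im (cinner x (A x)) = 0" for x
    by (metis assms(3) cinner_commute Reals_cnj_iff complex_is_Real_iff)
  then show ?thesis using assms by (simp add: positive_op_def bounded_clinear_def)
qed

text \<open>Polarisation: the forms of \<open>x + y\<close> and \<open>x + \<i>y\<close> are both real.\<close>
lemma positive_op_selfadjoint:
  assumes "positive_op A"
  shows "cinner (A x) y = cinner x (A y)"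
proof -
  interpret bounded_linear A using assms by (rule positive_op_bounded_linear)
  have im: "Im (cinner z (A z)) = 0" for z using assms by (simp add: positive_op_def)
  have "Im (cinner x (A y)) = - Im (cinner y (A x))"
    using im[of "x + y"] im[of x] im[of y]
    by (simp add: add cinner_add_left cinner_add_right)
  moreover have "Re (cinner x (A y)) = Re (cinner y (A x))"
    using im[of "x + \<i> *\<^sub>C y"] im[of x] im[of y]
    by (simp add: add cinner_add_left cinner_add_right positive_op_scaleC[OF assms]
        cinner_scaleC_left cinner_scaleC_right)
  ultimately have "cinner x (A y) = cnj (cinner y (A x))"
    by (simp add: complex_eq_iff)
  then show ?thesis by (metis cinner_commute)
qed

text \<open>Evaluate the form of \<open>B\<close> at \<open>x - B x / M\<close>.\<close>
lemma positive_op_norm_le_form: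
  assumes B: "positive_op B" and le: "\<And>y. Re (cinner y (B y)) \<le> Re (cinner y (A y))"
    and M: "M > 0" "\<And>y. norm (A y) \<le> M * norm y"
  shows "(norm (B x))\<^sup>2 \<le> M * Re (cinner x (B x))"
proof -
  interpret bounded_linear B using B by (rule positive_op_bounded_linear)
  define y where "y = B x"
  have 1: "Re (cinner x (B y)) = (norm y)\<^sup>2"
    by (metis B Re_cinner_self positive_op_selfadjoint y_def)
  have "Re (cinner y (B y)) \<le> cmod (cinner y (A y))"
    using le[of y] complex_Re_le_cmod order_trans by blast
  also have "\<dots> \<le> norm y * (M * norm y)"
    using cinner_Cauchy_Schwarz[of y "A y"] M(2)[of y]
    by (meson mult_left_mono norm_ge_zero order_trans)
  finally have 2: "Re (cinner y (B y)) \<le> M * (norm y)\<^sup>2"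
    by (simp add: power2_eq_square mult.commute mult.left_commute)
  have "0 \<le> Re (cinner (x - (1/M) *\<^sub>R y) (B (x - (1/M) *\<^sub>R y)))"
    using B by (rule positive_op_nonneg)
  also have "\<dots> = Re (cinner x (B x)) - 2 * (norm y)\<^sup>2 / M + Re (cinner y (B y)) / M\<^sup>2"
    using 1 M(1) by (simp add: diff scaleR cinner.diff_left cinner.diff_right cinner.scaleR_left
        cinner.scaleR_right y_def[symmetric] Re_cinner_self power2_eq_square field_simps)
  also have "\<dots> \<le> Re (cinner x (B x)) - 2 * (norm y)\<^sup>2 / M + M * (norm y)\<^sup>2 / M\<^sup>2"
    using 2 M(1) by (simp add: divide_right_mono)
  finally show ?thesis
    using M(1) by (simp add: y_def power2_eq_square field_simps)
qed

lemma positive_op_bound: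
  assumes "positive_op A"
  obtains M where "M > 0" "\<And>y. norm (A y) \<le> M * norm y"
  using bounded_linear.pos_bounded[OF positive_op_bounded_linear[OF assms]]
  by (metis mult.commute)

section \<open>The positive square root\<close>

text \<open>The iteration below for the number 1. It increases and stays below 1, so its telescoping
  increments are a summable majorant in operator norm.\<close>

fun sqrt_majorant :: "nat \<Rightarrow> real" where
  "sqrt_majorant 0 = 0"
| "sqrt_majorant (Suc n) = (1 + (sqrt_majorant n)\<^sup>2) / 2"

text \<open>A fixed point \<open>X = (C + X^2) / 2\<close> satisfies
  \<open>(I - X)^2 = I - C\<close>, so the iteration started at 0 aims at
  \<open>I - (I - C)^(1/2)\<close>. The type of bounded linear functions provides the operator
  norm.\<close>

fun sqrt_iter :: "('a::real_normed_vector \<Rightarrow>\<^sub>L 'a) \<Rightarrow> nat \<Rightarrow> ('a \<Rightarrow>\<^sub>L 'a)" where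
  "sqrt_iter C 0 = 0"
| "sqrt_iter C (Suc n) = (1/2) *\<^sub>R (C + (sqrt_iter C n o\<^sub>L sqrt_iter C n))"

lemma sqrt_majorant_bounds: "0 \<le> sqrt_majorant n \<and> sqrt_majorant n \<le> 1"
proof (induction n)
  case (Suc n)
  then have "(sqrt_majorant n)\<^sup>2 \<le> 1" by (simp add: power_le_one)
  then show ?case by simp
qed simp

lemma sqrt_majorant_mono: "incseq sqrt_majorant"
proof (rule incseq_SucI)
  fix n
  have "sqrt_majorant (Suc n) - sqrt_majorant n = (1 - sqrt_majorant n)\<^sup>2 / 2"
    by (simp add: power2_eq_square field_simps)
  then show "sqrt_majorant n \<le> sqrt_majorant (Suc n)"
    by (metis diff_ge_0_iff_ge divide_nonneg_nonneg zero_le_numeral zero_le_power2)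
qed

text \<open>Each iterate is a polynomial in \<open>C\<close>. This serves twice: iterates commute
  with each other, and the limit commutes with whatever commutes with \<open>C\<close>.\<close>

lemma sqrt_iter_commute:
  assumes "C o\<^sub>L D = D o\<^sub>L C"
  shows "sqrt_iter C n o\<^sub>L D = D o\<^sub>L sqrt_iter C n"
proof (induction n)
  case 0
  show ?case by (rule blinfun_eqI) simp
next
  case (Suc n)
  have c: "sqrt_iter C n (D x) = D (sqrt_iter C n x)" for x
    using arg_cong[OF Suc, of "\<lambda>F. F x"] by simp
  have d: "C (D x) = D (C x)" for x
    using arg_cong[OF assms, of "\<lambda>F. F x"] by simp
  show ?case
    by (rule blinfun_eqI) (simp add: blinfun.add_left blinfun.add_right blinfun.scaleR_left
        blinfun.scaleR_right c d)
qed

lemma sqrt_iter_norm_le: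
  assumes "norm C \<le> 1"
  shows "norm (sqrt_iter C n) \<le> sqrt_majorant n"
proof (induction n)
  case (Suc n)
  have "norm (sqrt_iter C (Suc n)) \<le> (norm C + norm (sqrt_iter C n o\<^sub>L sqrt_iter C n)) / 2"
    using norm_triangle_ineq[of C "sqrt_iter C n o\<^sub>L sqrt_iter C n"] by simp
  also have "\<dots> \<le> (1 + norm (sqrt_iter C n) * norm (sqrt_iter C n)) / 2"
    using assms norm_blinfun_compose[of "sqrt_iter C n" "sqrt_iter C n"] by simp
  also have "\<dots> \<le> (1 + (sqrt_majorant n)\<^sup>2) / 2"
    using Suc by (simp add: power2_eq_square mult_mono sqrt_majorant_bounds)
  finally show ?case by simp
qed simp

text \<open>The iterates commute, so \<open>X\<^sub>n\<^sup>2 - X\<^sub>n\<^sub>-\<^sub>1\<^sup>2\<close> factors and the increments are dominated by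
  those of the scalar iteration with \<open>C = 1\<close>.\<close>
lemma sqrt_iter_step_le:
  assumes "norm C \<le> 1"
  shows "norm (sqrt_iter C (Suc n) - sqrt_iter C n) \<le> sqrt_majorant (Suc n) - sqrt_majorant n"
proof (induction n)
  case 0
  show ?case using sqrt_iter_norm_le[OF assms, of 1] by simp
next
  case (Suc n)
  define X Y Z where "X = sqrt_iter C (Suc n)" and "Y = sqrt_iter C n"
    and "Z = sqrt_iter C (Suc (Suc n))"
  have XZ: "X = (1/2) *\<^sub>R (C + (Y o\<^sub>L Y))" "Z = (1/2) *\<^sub>R (C + (X o\<^sub>L X))"
    by (simp_all add: X_def Y_def Z_def)
  have "X o\<^sub>L Y = Y o\<^sub>L X"
    unfolding X_def Y_def by (intro sqrt_iter_commute sqrt_iter_commute[symmetric] refl)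
  then have "(X + Y) o\<^sub>L (X - Y) = (X o\<^sub>L X) - (Y o\<^sub>L Y)"
    by (simp add: bounded_bilinear.add_left[OF bounded_bilinear_blinfun_compose]
        bounded_bilinear.diff_right[OF bounded_bilinear_blinfun_compose])
  moreover have "Z - X = (1/2) *\<^sub>R (C + (X o\<^sub>L X)) - (1/2) *\<^sub>R (C + (Y o\<^sub>L Y))"
    using XZ by metis
  ultimately have "Z - X = (1/2) *\<^sub>R ((X + Y) o\<^sub>L (X - Y))"
    by (simp add: scaleR_right_diff_distrib scaleR_right_distrib)
  then have "norm (Z - X) = norm ((X + Y) o\<^sub>L (X - Y)) / 2"
    by simp
  also have "\<dots> \<le> (norm X + norm Y) * norm (X - Y) / 2"
    using norm_blinfun_compose[of "X + Y" "X - Y"] norm_triangle_ineq[of X Y]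
    by (meson divide_right_mono mult_right_mono norm_ge_zero order_trans zero_le_numeral)
  also have "\<dots> \<le> (sqrt_majorant (Suc n) + sqrt_majorant n)
      * (sqrt_majorant (Suc n) - sqrt_majorant n) / 2"
  proof (intro divide_right_mono mult_mono add_mono)
    show "norm X \<le> sqrt_majorant (Suc n)" "norm Y \<le> sqrt_majorant n"
      unfolding X_def Y_def by (rule sqrt_iter_norm_le[OF assms])+
    show "norm (X - Y) \<le> sqrt_majorant (Suc n) - sqrt_majorant n"
      unfolding X_def Y_def by (rule Suc)
    show "0 \<le> sqrt_majorant (Suc n) + sqrt_majorant n"
      using sqrt_majorant_bounds by (meson add_nonneg_nonneg)
  qed simp_all
  also have "\<dots> = sqrt_majorant (Suc (Suc n)) - sqrt_majorant (Suc n)"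
  proof -
    have "(a + b) * (a - b) / 2 = (1 + a\<^sup>2) / 2 - (1 + b\<^sup>2) / 2" for a b :: real
      by (simp add: power2_eq_square field_simps)
    from this[of "sqrt_majorant (Suc n)" "sqrt_majorant n"] show ?thesis
      by (simp only: sqrt_majorant.simps)
  qed
  finally show ?case unfolding X_def Z_def .
qed

text \<open>The increments are dominated by those of a bounded monotone real sequence, so their
  series converges absolutely, and completeness gives the limit.\<close>

lemma convergent_sqrt_iter:
  fixes C :: "'a::banach \<Rightarrow>\<^sub>L 'a"
  assumes "norm C \<le> 1"
  shows "convergent (sqrt_iter C)"
proof -
  have "Bseq sqrt_majorant"
    using sqrt_majorant_bounds by (intro BseqI'[of _ 1]) simp
  then have "convergent sqrt_majorant"
    using sqrt_majorant_mono by (simp add: Bseq_monoseq_convergent incseq_imp_monoseq)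
  then obtain l where l: "sqrt_majorant \<longlonglongrightarrow> l" by (auto simp: convergent_def)
  have "summable (\<lambda>n. sqrt_majorant (Suc n) - sqrt_majorant n)"
    using telescope_sums[OF l] by (rule sums_summable)
  then have "summable (\<lambda>n. sqrt_iter C (Suc n) - sqrt_iter C n)"
    by (rule summable_comparison_test'[where N = 0]) (use sqrt_iter_step_le[OF assms] in blast)
  then have "(\<lambda>n. \<Sum>k<n. sqrt_iter C (Suc k) - sqrt_iter C k)
      \<longlonglongrightarrow> (\<Sum>k. sqrt_iter C (Suc k) - sqrt_iter C k)"
    by (rule summable_LIMSEQ)
  moreover have "(\<Sum>k<n. sqrt_iter C (Suc k) - sqrt_iter C k) = sqrt_iter C n" for n
    by (simp only: sum_lessThan_telescope sqrt_iter.simps(1) diff_zero)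
  ultimately show ?thesis by (auto simp: convergent_def)
qed

lemma sqrt_iter_selfadjoint:
  fixes C :: "'a::complex_inner \<Rightarrow>\<^sub>L 'a"
  assumes "\<And>x y. cinner (C x) y = cinner x (C y)"
  shows "cinner (sqrt_iter C n x) y = cinner x (sqrt_iter C n y)"
proof (induction n arbitrary: x y)
  case (Suc n)
  then show ?case
    by (simp add: assms blinfun.add_left blinfun.scaleR_left cinner.add_left cinner.add_right
        cinner.scaleR_left cinner.scaleR_right)
qed (simp add: cinner.zero_left cinner.zero_right)

text \<open>With \<open>C = I - A/M\<close>, the limit \<open>X\<close> of the iteration satisfies \<open>X = (C + X\<^sup>2)/2\<close>, so
  \<open>(I - X)\<^sup>2 = A/M\<close>.\<close>
lemma positive_sqrt_exists_commuting:
  fixes A :: "'a::chilbert_space \<Rightarrow> 'a"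
  assumes A: "positive_op A"
  obtains B where "positive_op B" "B \<circ> B = A"
    "\<And>D. bounded_linear D \<Longrightarrow> D \<circ> A = A \<circ> D \<Longrightarrow> D \<circ> B = B \<circ> D"
proof -
  interpret A: bounded_linear A using A by (rule positive_op_bounded_linear)
  obtain M where M: "M > 0" "\<And>y. norm (A y) \<le> M * norm y"
    using positive_op_bound[OF A] by blast
  define C where "C = Blinfun (\<lambda>x. x - (1/M) *\<^sub>R A x)"
  have "bounded_linear (\<lambda>x. x - (1/M) *\<^sub>R A x)"
    by (intro bounded_linear_sub bounded_linear_ident bounded_linear_const_scaleR
        A.bounded_linear_axioms)
  then have C: "C x = x - (1/M) *\<^sub>R A x" for x
    unfolding C_def by (simp add: bounded_linear_Blinfun_apply)
  \<comment> \<open>In \<open>(norm (x - A x / M))^2\<close> the quadratic term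
    \<open>(norm (A x))^2 / M^2\<close> is at most \<open><x, A x> / M\<close>, so the cross term
    \<open>- 2 <x, A x> / M\<close> outweighs it.\<close>
  have "norm C \<le> 1"
  proof (rule norm_blinfun_bound)
    fix x
    have "(norm (A x))\<^sup>2 \<le> M * Re (cinner x (A x))"
      by (rule positive_op_norm_le_form[OF A order_refl M])
    then have "(norm (A x))\<^sup>2 / M\<^sup>2 \<le> Re (cinner x (A x)) / M"
      using M(1) by (simp add: power2_eq_square field_simps)
    moreover have "0 \<le> Re (cinner x (A x)) / M"
      using positive_op_nonneg[OF A] M(1) by simp
    ultimately have "(norm (C x))\<^sup>2 \<le> (norm x)\<^sup>2"
      unfolding C norm_diff_squared using M(1)
      by (simp add: cinner.scaleR_right power_divide)
    then show "norm (C x) \<le> 1 * norm x" by (simp add: power2_le_iff_abs_le)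
  qed simp
  then obtain X where X: "sqrt_iter C \<longlonglongrightarrow> X"
    using convergent_sqrt_iter by (auto simp: convergent_def)
  have Xx: "(\<lambda>n. sqrt_iter C n x) \<longlonglongrightarrow> X x" for x
    by (intro blinfun.tendsto X tendsto_const)
  have norm_X: "norm X \<le> 1"
    by (rule LIMSEQ_le_const2[OF tendsto_norm[OF X]])
      (meson \<open>norm C \<le> 1\<close> order_trans sqrt_iter_norm_le sqrt_majorant_bounds)
  have "(\<lambda>n. sqrt_iter C (Suc n)) \<longlonglongrightarrow> (1/2) *\<^sub>R (C + (X o\<^sub>L X))"
    unfolding sqrt_iter.simps
    by (intro tendsto_intros bounded_bilinear.tendsto[OF bounded_bilinear_blinfun_compose] X)
  with LIMSEQ_Suc[OF X] have "X = (1/2) *\<^sub>R (C + (X o\<^sub>L X))"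
    using LIMSEQ_unique by blast
  then have "X x = (1/2) *\<^sub>R (C x + X (X x))" for x
    by (metis blinfun.add_left blinfun.scaleR_left blinfun_apply_blinfun_compose)
  then have "2 *\<^sub>R X x = C x + X (X x)" for x
    by (metis (no_types) divide_self_if mult_1 scaleR_scaleR scaleR_one times_divide_eq_right
        zero_neq_numeral mult.commute)
  then have XX: "X x + X x = x - (1/M) *\<^sub>R A x + X (X x)" for x
    by (metis C scaleR_2)
  \<comment> \<open>Commutation passes from \<open>A\<close> to \<open>C\<close>, then to every
    iterate, and to the limit by continuity of \<open>D\<close>.\<close>
  have X_comm: "X (D x) = D (X x)" if D: "bounded_linear D" "D \<circ> A = A \<circ> D" for D x
  proof -
    interpret D: bounded_linear D by fact
    have DA: "D (A y) = A (D y)" for y using D(2) by (metis comp_apply)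
    have "C o\<^sub>L Blinfun D = Blinfun D o\<^sub>L C"
      by (rule blinfun_eqI) (simp add: bounded_linear_Blinfun_apply D(1) C D.diff D.scaleR DA)
    then have "sqrt_iter C n o\<^sub>L Blinfun D = Blinfun D o\<^sub>L sqrt_iter C n" for n
      by (rule sqrt_iter_commute)
    then have "sqrt_iter C n (D x) = D (sqrt_iter C n x)" for n
      by (metis D(1) blinfun_apply_blinfun_compose bounded_linear_Blinfun_apply)
    then have "(\<lambda>n. D (sqrt_iter C n x)) \<longlonglongrightarrow> X (D x)"
      using Xx[of "D x"] by simp
    moreover have "(\<lambda>n. D (sqrt_iter C n x)) \<longlonglongrightarrow> D (X x)"
      by (rule D.tendsto[OF Xx])
    ultimately show ?thesis by (rule LIMSEQ_unique)
  qed
  have X_self: "cinner (X x) y = cinner x (X y)" for x y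
  proof -
    have "cinner (C x) y = cinner x (C y)" for x y
      by (simp add: C cinner.diff_left cinner.diff_right cinner.scaleR_left cinner.scaleR_right
          positive_op_selfadjoint[OF A])
    then have "(\<lambda>n. cinner (sqrt_iter C n x) y) = (\<lambda>n. cinner x (sqrt_iter C n y))"
      using sqrt_iter_selfadjoint by blast
    moreover have "(\<lambda>n. cinner (sqrt_iter C n x) y) \<longlonglongrightarrow> cinner (X x) y"
      "(\<lambda>n. cinner x (sqrt_iter C n y)) \<longlonglongrightarrow> cinner x (X y)"
      by (intro cinner.tendsto Xx tendsto_const)+
    ultimately show ?thesis using LIMSEQ_unique by metis
  qed
  define B where "B = (\<lambda>x. sqrt M *\<^sub>R (x - X x))"
  have blB: "bounded_linear B"
    unfolding B_def by (intro bounded_linear_const_scaleR bounded_linear_sub bounded_linear_ident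
        blinfun.bounded_linear_right)
  have DB: "D \<circ> B = B \<circ> D" if D: "bounded_linear D" "D \<circ> A = A \<circ> D" for D
  proof -
    interpret D: bounded_linear D by fact
    show ?thesis by (rule ext) (simp add: B_def D.diff D.scaleR X_comm[OF D])
  qed
  have "positive_op B"
  proof (rule positive_opI[OF blB])
    \<comment> \<open>Complex linearity is an instance of commutation: \<open>D\<close> is only
      required to be real-linear, so it may be multiplication by the scalar
      \<open>c\<close>.\<close>
    show "B (c *\<^sub>C x) = c *\<^sub>C B x" for c x
      using DB[OF bounded_linear_scaleC[of c]] positive_op_scaleC[OF A, of c]
      by (auto simp: fun_eq_iff)
    show "cinner (B x) y = cinner x (B y)" for x y
      by (simp add: B_def cinner.diff_left cinner.diff_right cinner.scaleR_left
          cinner.scaleR_right X_self)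
    \<comment> \<open>Positivity of \<open>I - X\<close> follows from \<open>norm X \<le> 1\<close>
      and Cauchy-Schwarz.\<close>
    show "0 \<le> Re (cinner x (B x))" for x
    proof -
      have "Re (cinner x (X x)) \<le> norm x * norm (X x)"
        using cinner_Cauchy_Schwarz[of x "X x"] complex_Re_le_cmod order_trans by blast
      also have "\<dots> \<le> norm x * (1 * norm x)"
        using norm_blinfun[of X x] norm_X
        by (intro mult_left_mono) (meson mult_right_mono norm_ge_zero order_trans, simp)
      finally show ?thesis
        using M(1) by (simp add: B_def cinner.scaleR_right cinner.diff_right Re_cinner_self
            power2_eq_square)
    qed
  qed
  moreover have "B \<circ> B = A"
  proof
    fix x
    have "(B \<circ> B) x = (sqrt M * sqrt M) *\<^sub>R (x - (X x + X x) + X (X x))"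
      by (simp add: B_def blinfun.diff_right blinfun.scaleR_right algebra_simps)
    also have "\<dots> = A x" unfolding XX using M(1) by simp
    finally show "(B \<circ> B) x = A x" .
  qed
  ultimately show thesis using that DB by blast
qed

section \<open>Uniqueness of the positive square root\<close>

lemma norm_squared_sqrt:
  assumes "positive_op B" "B \<circ> B = A"
  shows "(norm (B x))\<^sup>2 = Re (cinner x (A x))"
  unfolding Re_cinner_self[symmetric] positive_op_selfadjoint[OF assms(1)] assms(2)[symmetric]
  by simp

text \<open>A second root \<open>B'\<close> commutes with \<open>A\<close>, hence with the
  constructed root \<open>B\<close>. For \<open>y = B' x - B x\<close> this gives
  \<open>B' y + B y = 0\<close>; both forms at \<open>y\<close> are nonnegative and so vanish,
  whence \<open>B y = B' y = 0\<close>. Then \<open><y, y> = <x, B' y - B y> = 0\<close>. This makes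
  the description in \<open>op_sqrt\<close> well defined.\<close>

lemma positive_sqrt_ex1:
  fixes A :: "'a::chilbert_space \<Rightarrow> 'a"
  assumes A: "positive_op A"
  shows "\<exists>!B. positive_op B \<and> B \<circ> B = A"
proof -
  obtain B where B: "positive_op B" "B \<circ> B = A"
    and comm: "\<And>D. bounded_linear D \<Longrightarrow> D \<circ> A = A \<circ> D \<Longrightarrow> D \<circ> B = B \<circ> D"
    using positive_sqrt_exists_commuting[OF A] by blast
  have "B' = B" if B': "positive_op B'" "B' \<circ> B' = A" for B'
  proof
    fix x
    interpret B: bounded_linear B using B(1) by (rule positive_op_bounded_linear)
    interpret B': bounded_linear B' using B'(1) by (rule positive_op_bounded_linear)
    have "B' \<circ> A = A \<circ> B'" unfolding B'(2)[symmetric] by (simp only: comp_assoc)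
    then have "B' \<circ> B = B \<circ> B'" by (rule comm[OF B'.bounded_linear_axioms])
    then have c: "B' (B z) = B (B' z)" for z by (simp add: fun_eq_iff)
    have sq: "B' (B' z) = B (B z)" for z
      using fun_cong[OF B(2), of z] fun_cong[OF B'(2), of z] by simp
    define y where "y = B' x - B x"
    have "B' y + B y = 0" by (simp add: y_def B.diff B'.diff c sq)
    then have "cinner y (B' y) + cinner y (B y) = 0"
      unfolding cinner.add_right[symmetric] by (simp add: cinner.zero_right)
    then have "Re (cinner y (B' y)) + Re (cinner y (B y)) = 0"
      by (simp add: complex_eq_iff)
    then have z: "Re (cinner y (B' y)) = 0" "Re (cinner y (B y)) = 0"
      using positive_op_nonneg[OF B(1), of y] positive_op_nonneg[OF B'(1), of y] by linarith+
    have null: "D y = 0" if D: "positive_op D" "Re (cinner y (D y)) = 0" for D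
    proof -
      obtain M where "M > 0" "\<And>y. norm (D y) \<le> M * norm y"
        using positive_op_bound[OF D(1)] by blast
      from positive_op_norm_le_form[OF D(1) order_refl this, of y] D(2) show ?thesis by simp
    qed
    have "cinner y y = cinner x (B' y) - cinner x (B y)"
      by (subst (1) y_def) (simp add: cinner.diff_left positive_op_selfadjoint[OF B(1)]
          positive_op_selfadjoint[OF B'(1)])
    then have "y = 0"
      using null[OF B(1) z(2)] null[OF B'(1) z(1)] by (simp add: cinner.zero_right cinner_eq_zero_iff)
    then show "B' x = B x" by (simp add: y_def)
  qed
  then show ?thesis using B by blast
qed

lemma op_sqrt:
  fixes A :: "'a::chilbert_space \<Rightarrow> 'a"
  assumes "positive_op A"
  shows op_sqrt_positive: "positive_op (op_sqrt A)"
    and op_sqrt_square: "op_sqrt A \<circ> op_sqrt A = A"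
  using theI'[OF positive_sqrt_ex1[OF assms]] unfolding op_sqrt_def by auto

lemma op_sqrt_orth_proj:
  fixes Q :: "'a::chilbert_space \<Rightarrow> 'a"
  assumes "orth_proj Q"
  shows "positive_op Q" "op_sqrt Q = Q"
proof -
  have "Re (cinner x (Q x)) = (norm (Q x))\<^sup>2" for x
    using assms unfolding orth_proj_def Re_cinner_self[symmetric] by metis
  then show "positive_op Q"
    using assms by (intro positive_opI) (auto simp: orth_proj_def bounded_clinear_def)
  moreover have "Q \<circ> Q = Q" using assms by (auto simp: orth_proj_def)
  ultimately show "op_sqrt Q = Q"
    unfolding op_sqrt_def by (intro the1_equality positive_sqrt_ex1) auto
qed

text \<open>For \<open>z\<^sub>n = (I - A/M)\<^sup>n x\<close> the vectors \<open>x - z\<^sub>n\<close> lie in the range of \<open>A\<close>, and \<open>B z\<^sub>n \<rightarrow> 0\<close>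
  because \<open>\<parallel>B z\<^sub>n\<parallel>\<^sup>2\<close> is bounded by a multiple of the decrement of \<open>\<parallel>z\<^sub>n\<parallel>\<^sup>2\<close>.\<close>
lemma range_op_sqrt_subset_closure_range:
  fixes A :: "'a::chilbert_space \<Rightarrow> 'a"
  assumes A: "positive_op A"
  shows "range (op_sqrt A) \<subseteq> closure (range A)"
proof clarify
  fix x
  define B where "B = op_sqrt A"
  have B: "positive_op B" "B \<circ> B = A" using op_sqrt[OF A] by (auto simp: B_def)
  interpret A: bounded_linear A using A by (rule positive_op_bounded_linear)
  interpret B: bounded_linear B using B(1) by (rule positive_op_bounded_linear)
  have AB: "A (B z) = B (A z)" for z
    unfolding B(2)[symmetric] by simp
  obtain M where M: "M > 0" "\<And>y. norm (A y) \<le> M * norm y"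
    using positive_op_bound[OF A] by blast
  define z where "z n = ((\<lambda>v. v - (1/M) *\<^sub>R A v) ^^ n) x" for n
  have z_Suc: "z (Suc n) = z n - (1/M) *\<^sub>R A (z n)" for n by (simp add: z_def)
  have dec: "(norm (B (z n)))\<^sup>2 \<le> M * ((norm (z n))\<^sup>2 - (norm (z (Suc n)))\<^sup>2)" for n
  proof -
    have "(norm (A (z n)))\<^sup>2 \<le> M * Re (cinner (z n) (A (z n)))"
      by (rule positive_op_norm_le_form[OF A order_refl M])
    then have "(norm (A (z n)))\<^sup>2 / M \<le> Re (cinner (z n) (A (z n)))"
      using M(1) by (simp add: field_simps)
    moreover have "M * ((norm (z n))\<^sup>2 - (norm (z (Suc n)))\<^sup>2)
        = 2 * Re (cinner (z n) (A (z n))) - (norm (A (z n)))\<^sup>2 / M"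
      unfolding z_Suc norm_diff_squared using M(1)
      by (simp add: cinner.scaleR_right power_divide power2_eq_square field_simps)
    ultimately show ?thesis unfolding norm_squared_sqrt[OF B] by linarith
  qed
  have "decseq (\<lambda>n. (norm (z n))\<^sup>2)"
  proof (rule decseq_SucI)
    fix n
    have "0 \<le> M * ((norm (z n))\<^sup>2 - (norm (z (Suc n)))\<^sup>2)"
      using dec[of n] by (rule order_trans[OF zero_le_power2])
    then show "(norm (z (Suc n)))\<^sup>2 \<le> (norm (z n))\<^sup>2"
      using M(1) by (simp add: zero_le_mult_iff)
  qed
  then obtain l where l: "(\<lambda>n. (norm (z n))\<^sup>2) \<longlonglongrightarrow> l"
    by (rule decseq_convergent[where B = 0]) (use zero_le_power2 in blast)+
  have "(\<lambda>n. M * ((norm (z n))\<^sup>2 - (norm (z (Suc n)))\<^sup>2)) \<longlonglongrightarrow> M * (l - l)"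
    by (intro tendsto_mult tendsto_diff tendsto_const l LIMSEQ_Suc[OF l])
  then have "(\<lambda>n. M * ((norm (z n))\<^sup>2 - (norm (z (Suc n)))\<^sup>2)) \<longlonglongrightarrow> 0" by simp
  then have "(\<lambda>n. (norm (B (z n)))\<^sup>2) \<longlonglongrightarrow> 0"
    by (rule Lim_null_comparison[rotated]) (simp add: dec)
  then have "(\<lambda>n. sqrt ((norm (B (z n)))\<^sup>2)) \<longlonglongrightarrow> sqrt 0" by (rule tendsto_real_sqrt)
  then have "(\<lambda>n. norm (B (z n))) \<longlonglongrightarrow> 0" by simp
  then have "(\<lambda>n. B (z n)) \<longlonglongrightarrow> 0" by (rule tendsto_norm_zero_cancel)
  then have "(\<lambda>n. B x - B (z n)) \<longlonglongrightarrow> B x - 0" by (intro tendsto_diff tendsto_const)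
  then have lim: "(\<lambda>n. B x - B (z n)) \<longlonglongrightarrow> B x" by (simp only: diff_zero)
  \<comment> \<open>Since \<open>A\<close> and \<open>B\<close> commute, each step of the iteration
    adds \<open>A (B (z n)) / M\<close>, which again lies in the range of \<open>A\<close>.\<close>
  have "B x - B (z n) \<in> range A" for n
  proof (induction n)
    case 0
    show ?case by (rule range_eqI[of _ _ 0]) (simp add: z_def A.zero)
  next
    case (Suc n)
    then obtain y where y: "B x - B (z n) = A y" ..
    have "B x - B (z (Suc n)) = (B x - B (z n)) + (1/M) *\<^sub>R A (B (z n))"
      by (simp add: z_Suc B.diff B.scaleR AB)
    also have "\<dots> = A (y + (1/M) *\<^sub>R B (z n))"
      by (simp only: y A.add A.scaleR)
    finally show ?case by (rule range_eqI)
  qed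
  then have "B x \<in> closure (range A)"
    unfolding closure_sequential using lim by (intro exI[of _ "\<lambda>n. B x - B (z n)"]) simp
  then show "op_sqrt A x \<in> closure (range A)" by (simp only: B_def)
qed

section \<open>Orthonormal bases and the trace\<close>

text \<open>Pythagoras with the square completed in the coefficients. The Fourier coefficients give
  Bessel's inequality; arbitrary ones show that no combination approximates better.\<close>

lemma norm_diff_orthonormal_combination:
  fixes x :: "'a::complex_inner"
  assumes "finite F" "orthonormal F"
  shows "(norm (x - (\<Sum>e\<in>F. c e *\<^sub>C e)))\<^sup>2
    = (norm x)\<^sup>2 - (\<Sum>e\<in>F. (cmod (cinner e x))\<^sup>2) + (\<Sum>e\<in>F. (cmod (c e - cinner e x))\<^sup>2)"
  using assms
proof (induction F)
  case empty
  show ?case by simp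
next
  case (insert f F)
  define y where "y = (\<Sum>e\<in>F. c e *\<^sub>C e)"
  have f: "norm f = 1" "orthonormal F" "\<And>e. e \<in> F \<Longrightarrow> cinner e f = 0"
    using insert.prems insert.hyps by (auto simp: orthonormal_def)
  then have "cinner y f = 0"
    by (simp add: y_def cinner.sum_left cinner_scaleC_left)
  then have "Re (cinner (x - y) (c f *\<^sub>C f)) = Re (c f * cnj (cinner f x))"
    using cinner_commute[of x f] by (simp add: cinner.diff_left cinner_scaleC_right)
  moreover have "(cmod (c f - cinner f x))\<^sup>2
      = (cmod (c f))\<^sup>2 - 2 * Re (c f * cnj (cinner f x)) + (cmod (cinner f x))\<^sup>2"
    unfolding cmod_power2 by (simp add: power2_eq_square algebra_simps)
  moreover have "(norm (x - (\<Sum>e\<in>insert f F. c e *\<^sub>C e)))\<^sup>2 = (norm ((x - y) - c f *\<^sub>C f))\<^sup>2"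
    using insert.hyps by (simp add: y_def diff_diff_eq add.commute)
  moreover have "(norm ((x - y) - c f *\<^sub>C f))\<^sup>2
      = (norm (x - y))\<^sup>2 - 2 * Re (cinner (x - y) (c f *\<^sub>C f)) + (cmod (c f))\<^sup>2"
    by (subst norm_diff_squared) (simp add: norm_scaleC f(1))
  ultimately show ?case
    using insert.IH[OF f(2)] insert.hyps unfolding y_def[symmetric] by simp
qed

lemma orthonormal_subset: "orthonormal B \<Longrightarrow> F \<subseteq> B \<Longrightarrow> orthonormal F"
  by (auto simp: orthonormal_def)

lemma Bessel_inequality:
  assumes "finite F" "orthonormal F"
  shows "(\<Sum>e\<in>F. (cmod (cinner e x))\<^sup>2) \<le> (norm x)\<^sup>2"
proof -
  have "0 \<le> (norm (x - (\<Sum>e\<in>F. cinner e x *\<^sub>C e)))\<^sup>2" by simp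
  also have "\<dots> = (norm x)\<^sup>2 - (\<Sum>e\<in>F. (cmod (cinner e x))\<^sup>2)"
    by (subst norm_diff_orthonormal_combination[OF assms]) simp
  finally show ?thesis by simp
qed

text \<open>Bessel bounds the sum from above. For the lower bound, density of the span gives a
  finite combination near \<open>x\<close>, and the Fourier coefficients on the same finite set do
  at least as well.\<close>

lemma Parseval_identity:
  fixes x :: "'a::complex_inner"
  assumes B: "is_onb B"
  shows "((\<lambda>e. (cmod (cinner e x))\<^sup>2) has_sum (norm x)\<^sup>2) B"
proof -
  let ?f = "\<lambda>e. (cmod (cinner e x))\<^sup>2"
  have le: "sum ?f F \<le> (norm x)\<^sup>2" if "finite F" "F \<subseteq> B" for F
    by (rule Bessel_inequality[OF that(1) orthonormal_subset[OF _ that(2)]])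
      (use B in \<open>simp add: is_onb_def\<close>)
  have sm: "?f summable_on B"
  proof (rule nonneg_bdd_above_summable_on)
    show "bdd_above (sum ?f ` {F. F \<subseteq> B \<and> finite F})"
      by (rule bdd_aboveI2[of _ _ "(norm x)\<^sup>2"]) (simp add: le)
  qed simp
  have "(norm x)\<^sup>2 \<le> infsum ?f B"
  proof (rule field_le_epsilon)
    fix \<epsilon> :: real assume "\<epsilon> > 0"
    have "x \<in> closure (cspan B)" using B by (simp add: is_onb_def)
    moreover have "sqrt \<epsilon> > 0" using \<open>\<epsilon> > 0\<close> by simp
    ultimately obtain y where y: "y \<in> cspan B" "dist y x < sqrt \<epsilon>"
      unfolding closure_approachable by blast
    obtain F c where F: "finite F" "F \<subseteq> B" "y = (\<Sum>v\<in>F. c v *\<^sub>C v)"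
      using y(1) unfolding cspan_def by blast
    have on: "orthonormal F"
      using B F(2) orthonormal_subset unfolding is_onb_def by metis
    have "(norm x)\<^sup>2 - sum ?f F \<le> (norm (x - y))\<^sup>2"
      unfolding F(3) norm_diff_orthonormal_combination[OF F(1) on]
      using sum_nonneg[of F "\<lambda>e. (cmod (c e - cinner e x))\<^sup>2"] by simp
    also have "\<dots> \<le> (sqrt \<epsilon>)\<^sup>2"
      using y(2) by (intro power_mono) (simp_all add: dist_norm norm_minus_commute)
    also have "\<dots> = \<epsilon>" using \<open>\<epsilon> > 0\<close> by simp
    finally have "(norm x)\<^sup>2 \<le> sum ?f F + \<epsilon>" by simp
    also have "sum ?f F \<le> infsum ?f B"
      by (rule finite_sum_le_infsum[OF sm F(1,2)]) simp
    finally show "(norm x)\<^sup>2 \<le> infsum ?f B + \<epsilon>" by simp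
  qed
  moreover have "infsum ?f B \<le> (norm x)\<^sup>2"
    by (rule infsum_le_finite_sums[OF sm le])
  ultimately have "infsum ?f B = (norm x)\<^sup>2" by simp
  with has_sum_infsum[OF sm] show ?thesis by simp
qed

lemma has_sum_finite_sum:
  fixes f :: "'j \<Rightarrow> 'i \<Rightarrow> 'b::topological_comm_monoid_add"
  assumes "finite J" "\<And>j. j \<in> J \<Longrightarrow> (f j has_sum s j) A"
  shows "((\<lambda>x. \<Sum>j\<in>J. f j x) has_sum (\<Sum>j\<in>J. s j)) A"
  using assms
proof (induction J)
  case (insert j J)
  have "((\<lambda>x. f j x + (\<Sum>j\<in>J. f j x)) has_sum (s j + (\<Sum>j\<in>J. s j))) A"
    by (rule has_sum_add) (use insert in auto)
  with insert.hyps show ?case by simp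
qed simp

section \<open>Basis independence and monotonicity of the trace\<close>

lemma cmod_cinner_squared_le: "(cmod (cinner x y))\<^sup>2 \<le> (norm x)\<^sup>2 * (norm y)\<^sup>2"
  unfolding power_mult_distrib[symmetric]
  by (intro power_mono cinner_Cauchy_Schwarz norm_ge_zero)

lemma cmod_cinner_selfadjoint:
  assumes "positive_op S"
  shows "cmod (cinner e (S x)) = cmod (cinner x (S e))"
proof -
  have "cinner e (S x) = cnj (cinner (S x) e)" by (rule cinner_commute)
  then show ?thesis by (simp add: positive_op_selfadjoint[OF assms])
qed

text \<open>For finite \<open>F\<close> in the new basis, Parseval in the old basis and symmetry of
  \<open>S\<close> turn the partial sum into a double sum of \<open>|<f, S e>|^2\<close>; Bessel
  over \<open>F\<close> bounds it by the old sum.\<close>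

lemma square_summable_onb_change:
  assumes S: "positive_op S" and B: "is_onb B" "is_onb B'"
    and sm: "(\<lambda>e. (norm (S e))\<^sup>2) summable_on B"
  shows "(\<lambda>e. (norm (S e))\<^sup>2) summable_on B'"
proof (rule nonneg_bdd_above_summable_on)
  have "(\<Sum>f\<in>F. (norm (S f))\<^sup>2) \<le> infsum (\<lambda>e. (norm (S e))\<^sup>2) B" if F: "finite F" "F \<subseteq> B'" for F
  proof -
    have on: "orthonormal F"
      using B F(2) orthonormal_subset unfolding is_onb_def by metis
    have "((\<lambda>e. \<Sum>f\<in>F. (cmod (cinner e (S f)))\<^sup>2) has_sum (\<Sum>f\<in>F. (norm (S f))\<^sup>2)) B"
      by (rule has_sum_finite_sum[OF F(1) Parseval_identity[OF B(1)]])
    moreover have "(\<Sum>f\<in>F. (cmod (cinner e (S f)))\<^sup>2) \<le> (norm (S e))\<^sup>2" for e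
      unfolding cmod_cinner_selfadjoint[OF S, of e] by (rule Bessel_inequality[OF F(1) on])
    ultimately show ?thesis
      by (rule has_sum_mono[OF _ has_sum_infsum[OF sm]])
  qed
  then show "bdd_above (sum (\<lambda>e. (norm (S e))\<^sup>2) ` {F. F \<subseteq> B' \<and> finite F})"
    by (auto intro!: bdd_aboveI2)
qed simp

text \<open>\<open>trace_class_pos\<close> provides some basis while \<open>trace_pos\<close> uses a
  chosen one. Applying the change of basis to the root of \<open>A\<close> bridges the two.\<close>

lemma trace_class_pos_summable:
  fixes A :: "'a::chilbert_space \<Rightarrow> 'a"
  assumes "trace_class_pos A" "is_onb B'"
  shows "(\<lambda>e. Re (cinner e (A e))) summable_on B'"
proof -
  have A: "positive_op A" using assms(1) by (simp add: trace_class_pos_def)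
  obtain B where B: "is_onb B" "(\<lambda>e. Re (cinner e (A e))) summable_on B"
    using assms(1) by (auto simp: trace_class_pos_def)
  then show ?thesis
    using square_summable_onb_change[OF op_sqrt_positive[OF A] B(1) assms(2)]
    by (simp add: norm_squared_sqrt[OF op_sqrt[OF A]])
qed

lemma trace_class_pos_has_sum:
  fixes A :: "'a::chilbert_space \<Rightarrow> 'a"
  assumes "trace_class_pos A"
  shows "is_onb (SOME B::'a set. is_onb B)"
    and "((\<lambda>e. Re (cinner e (A e))) has_sum trace_pos A) (SOME B. is_onb B)"
proof -
  show onb: "is_onb (SOME B::'a set. is_onb B)"
    using assms unfolding trace_class_pos_def by (auto intro: someI)
  show "((\<lambda>e. Re (cinner e (A e))) has_sum trace_pos A) (SOME B. is_onb B)"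
    unfolding trace_pos_def using trace_class_pos_summable[OF assms onb] by (rule has_sum_infsum)
qed

lemma trace_class_pos_mono:
  assumes "trace_class_pos A" "positive_op B"
    and "\<And>x. Re (cinner x (B x)) \<le> Re (cinner x (A x))"
  shows "trace_class_pos B"
proof -
  obtain E where E: "is_onb E" "(\<lambda>e. Re (cinner e (A e))) summable_on E"
    using assms(1) by (auto simp: trace_class_pos_def)
  from E(2) have "(\<lambda>e. Re (cinner e (B e))) summable_on E"
    by (rule summable_on_comparison_test) (use assms in \<open>auto intro: positive_op_nonneg\<close>)
  with E(1) assms(2) show ?thesis by (auto simp: trace_class_pos_def)
qed

lemma trace_pos_nonneg:
  fixes A :: "'a::chilbert_space \<Rightarrow> 'a"
  assumes "trace_class_pos A"
  shows "0 \<le> trace_pos A"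
  by (rule has_sum_nonneg[OF trace_class_pos_has_sum(2)[OF assms]])
    (use assms in \<open>simp add: trace_class_pos_def positive_op_nonneg\<close>)

lemma trace_pos_add:
  fixes A :: "'a::chilbert_space \<Rightarrow> 'a"
  assumes "trace_class_pos A" "trace_class_pos B" "trace_class_pos C"
    and "\<And>x. C x = A x + B x"
  shows "trace_pos C = trace_pos A + trace_pos B"
proof -
  have "((\<lambda>e. Re (cinner e (C e))) has_sum (trace_pos A + trace_pos B)) (SOME B. is_onb B)"
    using has_sum_add[OF trace_class_pos_has_sum(2)[OF assms(1)] trace_class_pos_has_sum(2)[OF assms(2)]]
    by (simp add: assms(4) cinner.add_right)
  with trace_class_pos_has_sum(2)[OF assms(3)] show ?thesis by (rule has_sum_unique)
qed

lemma trace_pos_le_sum: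
  fixes A :: "'a::chilbert_space \<Rightarrow> 'a"
  assumes "trace_class_pos A" "finite J" "\<And>j. j \<in> J \<Longrightarrow> trace_class_pos (D j)"
    and "\<And>x. c * Re (cinner x (A x)) \<le> (\<Sum>j\<in>J. Re (cinner x (D j x)))"
  shows "c * trace_pos A \<le> (\<Sum>j\<in>J. trace_pos (D j))"
  by (rule has_sum_mono[OF has_sum_cmult_right[OF trace_class_pos_has_sum(2)[OF assms(1)]]
        has_sum_finite_sum[OF assms(2) trace_class_pos_has_sum(2)[OF assms(3)]] assms(4)])

text \<open>The trace dominates the operator norm: expand \<open>op_sqrt A x\<close> by Parseval,
  move the root onto the basis vectors and use Cauchy-Schwarz in each term.\<close>

lemma form_le_trace_pos:
  fixes A :: "'a::chilbert_space \<Rightarrow> 'a"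
  assumes "trace_class_pos A"
  shows "Re (cinner x (A x)) \<le> trace_pos A * (norm x)\<^sup>2"
proof -
  have A: "positive_op A" using assms by (simp add: trace_class_pos_def)
  define S where "S = op_sqrt A"
  have S: "positive_op S" "S \<circ> S = A" using op_sqrt[OF A] by (auto simp: S_def)
  have "((\<lambda>e. (cmod (cinner e (S x)))\<^sup>2) has_sum Re (cinner x (A x))) (SOME B. is_onb B)"
    using Parseval_identity[OF trace_class_pos_has_sum(1)[OF assms], of "S x"]
    by (simp add: norm_squared_sqrt[OF S])
  moreover have "((\<lambda>e. Re (cinner e (A e)) * (norm x)\<^sup>2) has_sum trace_pos A * (norm x)\<^sup>2)
      (SOME B. is_onb B)"
    by (rule has_sum_cmult_left[OF trace_class_pos_has_sum(2)[OF assms]])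
  moreover have "(cmod (cinner e (S x)))\<^sup>2 \<le> Re (cinner e (A e)) * (norm x)\<^sup>2" for e
    unfolding cmod_cinner_selfadjoint[OF S(1), of e x] norm_squared_sqrt[OF S, symmetric]
    using cmod_cinner_squared_le[of x "S e"] by (simp only: mult.commute)
  ultimately show ?thesis by (rule has_sum_mono)
qed

section \<open>The energy tree\<close>

lemma positive_op_sandwich:
  assumes S: "positive_op S" and Q: "positive_op Q"
  shows "positive_op (S \<circ> Q \<circ> S)"
proof (rule positive_opI)
  show "bounded_linear (S \<circ> Q \<circ> S)"
    using S Q bounded_linear_compose positive_op_bounded_linear unfolding comp_def by metis
  show "(S \<circ> Q \<circ> S) (c *\<^sub>C x) = c *\<^sub>C (S \<circ> Q \<circ> S) x" for c x
    by (simp add: positive_op_scaleC[OF S] positive_op_scaleC[OF Q])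
  show "cinner ((S \<circ> Q \<circ> S) x) y = cinner x ((S \<circ> Q \<circ> S) y)" for x y
    by (simp add: positive_op_selfadjoint[OF S] positive_op_selfadjoint[OF Q])
  show "0 \<le> Re (cinner x ((S \<circ> Q \<circ> S) x))" for x
    using positive_op_nonneg[OF Q, of "S x"] by (simp add: positive_op_selfadjoint[OF S])
qed

lemma orth_proj_complement:
  assumes "orth_proj Q"
  shows "orth_proj (\<lambda>x. x - Q x)"
proof -
  have Q: "bounded_linear Q" "\<And>c x. Q (c *\<^sub>C x) = c *\<^sub>C Q x" "\<And>x. Q (Q x) = Q x"
    "\<And>x y. cinner (Q x) y = cinner x (Q y)"
    using assms by (auto simp: orth_proj_def bounded_clinear_def)
  interpret bounded_linear Q by fact
  have "bounded_linear (\<lambda>x. x - Q x)"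
    by (intro bounded_linear_sub bounded_linear_ident Q)
  moreover have "c *\<^sub>C x - Q (c *\<^sub>C x) = c *\<^sub>C (x - Q x)" for c x
    using linear_diff[OF bounded_linear.linear[OF bounded_linear_scaleC[of c]], of x "Q x"]
    by (simp only: Q(2))
  ultimately show ?thesis
    by (simp add: orth_proj_def bounded_clinear_def diff Q cinner.diff_left cinner.diff_right)
qed

locale energy_tree =
  fixes m :: nat and P :: "nat \<Rightarrow> 'a::chilbert_space \<Rightarrow> 'a" and R0 :: "'a \<Rightarrow> 'a" and \<alpha> :: real
  assumes proj: "j \<in> {1..m} \<Longrightarrow> orth_proj (P j)"
    and R0_tc: "trace_class_pos R0"
    and \<alpha>_pos: "\<alpha> > 0"
    and leakage: "v \<in> closure (range (op_sqrt R0)) \<Longrightarrow>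
      \<alpha> * (norm v)\<^sup>2 \<le> Re (cinner v (\<Sum>j\<in>{1..m}. P j v))"
begin

abbreviation "R \<equiv> Rw R0 P"
abbreviation "D \<equiv> Dw R0 P"

lemma R0_pos: "positive_op R0"
  using R0_tc by (simp add: trace_class_pos_def)

lemma R_Nil: "R [] = R0"
  by (simp add: Rw_def)

lemma R_snoc: "R (w @ [j]) = op_sqrt (R w) \<circ> (\<lambda>x. x - P j x) \<circ> op_sqrt (R w)"
  by (simp add: Rw_def)

lemma R_pos: "set w \<subseteq> {1..m} \<Longrightarrow> positive_op (R w)"
proof (induction w rule: rev_induct)
  case Nil
  show ?case by (simp add: R_Nil R0_pos)
next
  case (snoc j w)
  then have "positive_op (R w)" "j \<in> {1..m}" by auto
  then show ?case
    unfolding R_snoc by (intro positive_op_sandwich op_sqrt_positive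
        op_sqrt_orth_proj(1)[OF orth_proj_complement] proj)
qed

lemma D_pos: "set w \<subseteq> {1..m} \<Longrightarrow> j \<in> {1..m} \<Longrightarrow> positive_op (D w j)"
  unfolding Dw_def by (intro positive_op_sandwich op_sqrt_positive R_pos op_sqrt_orth_proj(1) proj)

text \<open>With \<open>S\<close> the root of \<open>R w\<close>, this is
  \<open>S S = S P S + S (I - P) S\<close>, the identity that telescopes along a path.\<close>

lemma R_split:
  assumes "set w \<subseteq> {1..m}"
  shows "R w x = D w j x + R (w @ [j]) x"
proof -
  interpret bounded_linear "op_sqrt (R w)"
    by (intro positive_op_bounded_linear op_sqrt_positive R_pos assms)
  have "op_sqrt (R w) (op_sqrt (R w) x) = R w x"
    using fun_cong[OF op_sqrt_square[OF R_pos[OF assms]], of x] by simp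
  then show ?thesis by (simp add: R_snoc Dw_def diff)
qed

lemma form_split:
  assumes "set w \<subseteq> {1..m}"
  shows "Re (cinner x (R w x)) = Re (cinner x (D w j x)) + Re (cinner x (R (w @ [j]) x))"
  by (subst R_split[OF assms, of x j]) (simp add: cinner.add_right)

lemma R_le_R0: "set w \<subseteq> {1..m} \<Longrightarrow> Re (cinner x (R w x)) \<le> Re (cinner x (R0 x))"
proof (induction w rule: rev_induct)
  case Nil
  show ?case by (simp add: R_Nil)
next
  case (snoc j w)
  then have w: "set w \<subseteq> {1..m}" "j \<in> {1..m}" by auto
  show ?case
    using snoc.IH[OF w(1)] form_split[OF w(1), of x j] positive_op_nonneg[OF D_pos[OF w], of x]
    by linarith
qed

lemma R_tc: "set w \<subseteq> {1..m} \<Longrightarrow> trace_class_pos (R w)"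
  by (rule trace_class_pos_mono[OF R0_tc R_pos R_le_R0])

lemma D_tc:
  assumes w: "set w \<subseteq> {1..m}" and j: "j \<in> {1..m}"
  shows "trace_class_pos (D w j)"
proof (rule trace_class_pos_mono[OF R_tc[OF w] D_pos[OF w j]])
  have "set (w @ [j]) \<subseteq> {1..m}" using w j by simp
  then show "Re (cinner x (D w j x)) \<le> Re (cinner x (R w x))" for x
    using form_split[OF w, of x j] positive_op_nonneg[OF R_pos, of "w @ [j]" x] by linarith
qed

lemma trace_split:
  assumes w: "set w \<subseteq> {1..m}" and j: "j \<in> {1..m}"
  shows "trace_pos (R w) = trace_pos (D w j) + trace_pos (R (w @ [j]))"
  using w j by (intro trace_pos_add D_tc R_tc R_split) auto

text \<open>The range of a root lies in the closed range of its square, and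
  \<open>R (w @ [j])\<close> has the root of \<open>R w\<close> as its outer factor. Thus the
  leakage condition applies to every vector \<open>op_sqrt (R w) x\<close>.\<close>

lemma range_sqrt_R: "set w \<subseteq> {1..m} \<Longrightarrow> range (op_sqrt (R w)) \<subseteq> closure (range (op_sqrt R0))"
proof (induction w rule: rev_induct)
  case Nil
  show ?case by (simp add: R_Nil closure_subset)
next
  case (snoc j w)
  then have w: "set w \<subseteq> {1..m}" by simp
  have "range (op_sqrt (R (w @ [j]))) \<subseteq> closure (range (R (w @ [j])))"
    by (rule range_op_sqrt_subset_closure_range[OF R_pos[OF snoc.prems]])
  also have "\<dots> \<subseteq> closure (range (op_sqrt R0))"
    using snoc.IH[OF w] unfolding R_snoc by (intro closure_minimal) auto
  finally show ?case .
qed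

text \<open>Leakage at the vector \<open>op_sqrt (R w) x\<close> is an inequality between the forms
  of \<open>R w\<close> and of the \<open>D w j\<close> at \<open>x\<close>; summing over a basis
  gives traces.\<close>

lemma trace_leakage:
  assumes w: "set w \<subseteq> {1..m}"
  shows "\<alpha> * trace_pos (R w) \<le> (\<Sum>j\<in>{1..m}. trace_pos (D w j))"
proof (rule trace_pos_le_sum[OF R_tc[OF w] _ D_tc[OF w]])
  fix x
  let ?S = "op_sqrt (R w)"
  have S: "positive_op ?S" "?S \<circ> ?S = R w" using op_sqrt[OF R_pos[OF w]] by auto
  have "\<alpha> * Re (cinner x (R w x)) = \<alpha> * (norm (?S x))\<^sup>2"
    by (simp add: norm_squared_sqrt[OF S])
  also have "\<dots> \<le> Re (cinner (?S x) (\<Sum>j\<in>{1..m}. P j (?S x)))"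
    by (rule leakage) (use range_sqrt_R[OF w] in auto)
  also have "\<dots> = (\<Sum>j\<in>{1..m}. Re (cinner x (D w j x)))"
    by (simp add: cinner.sum_right Dw_def positive_op_selfadjoint[OF S(1)])
  finally show "\<alpha> * Re (cinner x (R w x)) \<le> (\<Sum>j\<in>{1..m}. Re (cinner x (D w j x)))" .
qed simp_all

text \<open>With \<open>s\<^sub>j = tr D\<^sub>w\<^sub>j\<close>, \<open>S = \<Sum>\<^sub>j s\<^sub>j\<close>, the expected loss is \<open>\<Sum>\<^sub>j s\<^sub>j\<^sup>2 / S\<close>, and
  \<open>\<Sum>\<^sub>j s\<^sub>j\<^sup>2 / S \<ge> S / m \<ge> \<alpha> tr R\<^sub>w / m\<close> by the Cauchy-Schwarz inequality.\<close>
lemma expected_trace_step: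
  assumes w: "set w \<subseteq> {1..m}" and m: "m > 0"
  shows "(\<Sum>j\<in>{1..m}. p_tr m q R0 P w j * trace_pos (R (w @ [j])))
    \<le> (1 - \<alpha> / m) * trace_pos (R w)"
proof -
  define T where "T = trace_pos (R w)"
  define s where "s j = trace_pos (D w j)" for j
  define S where "S = (\<Sum>j\<in>{1..m}. s j)"
  have leak: "\<alpha> * T \<le> S" using trace_leakage[OF w] by (simp add: T_def S_def s_def)
  have split: "trace_pos (R (w @ [j])) = T - s j" if "j \<in> {1..m}" for j
    using trace_split[OF w that] by (simp add: T_def s_def)
  show ?thesis
  proof (cases "S > 0")
    case True
    have "(\<Sum>j\<in>{1..m}. p_tr m q R0 P w j * trace_pos (R (w @ [j])))
        = (\<Sum>j\<in>{1..m}. T * (s j / S) - (s j)\<^sup>2 / S)"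
    proof (intro sum.cong refl)
      fix j assume j: "j \<in> {1..m}"
      have p: "p_tr m q R0 P w j = s j / S"
        using True unfolding S_def s_def by (simp add: p_tr_def Let_def)
      show "p_tr m q R0 P w j * trace_pos (R (w @ [j])) = T * (s j / S) - (s j)\<^sup>2 / S"
        unfolding p split[OF j] by (simp add: power2_eq_square algebra_simps diff_divide_distrib)
    qed
    also have "\<dots> = T - (\<Sum>j\<in>{1..m}. (s j)\<^sup>2) / S"
      unfolding sum_subtractf sum_distrib_left[symmetric] sum_divide_distrib[symmetric]
        S_def[symmetric] using True by simp
    also have "\<dots> \<le> T - S / m"
    proof -
      have "S\<^sup>2 \<le> (\<Sum>j\<in>{1..m}. (s j)\<^sup>2) * m"
        using sum_squared_le_sum_of_squares[of s "{1..m}"] by (simp add: S_def)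
      then have "S / m \<le> (\<Sum>j\<in>{1..m}. (s j)\<^sup>2) / S"
        using True m by (simp add: field_simps power2_eq_square)
      then show ?thesis by simp
    qed
    also have "\<dots> \<le> T - \<alpha> * T / m"
      using leak m by (simp add: divide_right_mono)
    finally show ?thesis by (simp add: T_def algebra_simps)
  next
    \<comment> \<open>Here the default weights \<open>q\<close> are in force, but leakage forces the
      trace of \<open>R w\<close>, and so of its children, to be zero.\<close>
    case False
    with leak have "\<alpha> * T \<le> 0" by simp
    moreover have "T \<ge> 0" unfolding T_def by (rule trace_pos_nonneg[OF R_tc[OF w]])
    ultimately have T: "T = 0" using \<alpha>_pos by (simp add: mult_le_0_iff)
    have "trace_pos (R (w @ [j])) = 0" if j: "j \<in> {1..m}" for j
    proof -
      have "trace_pos (R (w @ [j])) \<ge> 0" using w j by (intro trace_pos_nonneg R_tc) auto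
      moreover have "s j \<ge> 0" unfolding s_def by (intro trace_pos_nonneg D_tc w j)
      ultimately show ?thesis using split[OF j] T by simp
    qed
    then show ?thesis using T by (simp add: T_def)
  qed
qed

end

section \<open>Path measures\<close>

definition words :: "nat \<Rightarrow> nat \<Rightarrow> nat list set" where
  "words m n = {w. set w \<subseteq> {1..m} \<and> length w = n}"

lemma finite_words: "finite (words m n)"
  unfolding words_def by (rule finite_lists_length_eq) simp

text \<open>Words grow at the right end, matching both the recursion for \<open>R\<close> and the
  refinement of cylinders.\<close>

lemma words_Suc: "words m (Suc n) = (\<lambda>(w, j). w @ [j]) ` (words m n \<times> {1..m})"
proof (intro equalityI subsetI)
  fix v assume v: "v \<in> words m (Suc n)"
  then obtain w j where "v = w @ [j]"
    by (cases v rule: rev_cases) (auto simp: words_def)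
  with v show "v \<in> (\<lambda>(w, j). w @ [j]) ` (words m n \<times> {1..m})"
    by (auto simp: words_def intro!: image_eqI[of _ _ "(w, j)"])
qed (auto simp: words_def)

lemma sum_words_Suc:
  "(\<Sum>v\<in>words m (Suc n). f v) = (\<Sum>w\<in>words m n. \<Sum>j\<in>{1..m}. f (w @ [j]))"
proof -
  have "inj_on (\<lambda>(w, j). w @ [j]) (words m n \<times> {1..m})" by (auto simp: inj_on_def)
  then show ?thesis
    unfolding words_Suc by (subst sum.reindex) (simp_all add: sum.cartesian_product case_prod_beta)
qed

lemma prefix_Suc: "prefix \<omega> (Suc n) = prefix \<omega> n @ [\<omega> n]"
  by (simp add: prefix_def)

lemma space_Omega_space: "\<omega> \<in> space (Omega_space m) \<longleftrightarrow> (\<forall>i. \<omega> i \<in> {1..m})"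
  by (auto simp: Omega_space_def space_PiM PiE_def)

lemma prefix_words: "\<omega> \<in> space (Omega_space m) \<Longrightarrow> prefix \<omega> n \<in> words m n"
  by (auto simp: space_Omega_space prefix_def words_def)

lemma cylinder_sets:
  assumes "set w \<subseteq> {1..m}"
  shows "cylinder m w \<in> sets (Omega_space m)"
proof -
  have comp: "{\<omega> \<in> space (Omega_space m). \<omega> i = w ! i} \<in> sets (Omega_space m)"
    if "i < length w" for i
  proof -
    have "(\<lambda>\<omega>. \<omega> i) \<in> measurable (Omega_space m) (count_space {1..m})"
      unfolding Omega_space_def by (rule measurable_component_singleton) simp
    moreover have "{w ! i} \<in> sets (count_space {1..m})"
      using assms that nth_mem by fastforce
    ultimately have "(\<lambda>\<omega>. \<omega> i) -` {w ! i} \<inter> space (Omega_space m) \<in> sets (Omega_space m)"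
      by (rule measurable_sets)
    moreover have "(\<lambda>\<omega>. \<omega> i) -` {w ! i} \<inter> space (Omega_space m)
        = {\<omega> \<in> space (Omega_space m). \<omega> i = w ! i}" by auto
    ultimately show ?thesis by simp
  qed
  have "{\<omega> \<in> space (Omega_space m). \<forall>i\<in>{..<length w}. \<omega> i = w ! i} \<in> sets (Omega_space m)"
    by (rule sets.sets_Collect_finite_All) (simp_all add: comp)
  moreover have "cylinder m w = {\<omega> \<in> space (Omega_space m). \<forall>i\<in>{..<length w}. \<omega> i = w ! i}"
    unfolding cylinder_def by (subst list_eq_iff_nth_eq) (auto simp: prefix_def)
  ultimately show ?thesis by simp
qed

section \<open>Almost sure decay of the remaining trace\<close>

context energy_tree
begin

lemma AE_trace_tendsto_0:
  assumes nu: "is_nu_tr m q R0 P \<nu>" and m: "m > 0"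
  shows "AE \<omega> in \<nu>. (\<lambda>n. trace_pos (R (prefix \<omega> n))) \<longlonglongrightarrow> 0"
proof -
  have sets: "sets \<nu> = sets (Omega_space m)" using nu by (simp add: is_nu_tr_def)
  then have space: "space \<nu> = space (Omega_space m)" by (rule sets_eq_imp_space_eq)
  interpret prob_space \<nu> using nu by (simp add: is_nu_tr_def)
  have cyl: "measure \<nu> (cylinder m w) = (\<Prod>i<length w. p_tr m q R0 P (take i w) (w ! i))"
    if "set w \<subseteq> {1..m}" for w using nu that by (simp add: is_nu_tr_def)
  have cyl_sets: "cylinder m w \<in> sets \<nu>" if "w \<in> words m n" for w n
    using cylinder_sets that by (simp add: words_def sets)
  have cyl_snoc: "measure \<nu> (cylinder m (w @ [j])) = measure \<nu> (cylinder m w) * p_tr m q R0 P w j"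
    if "set w \<subseteq> {1..m}" "j \<in> {1..m}" for w j
    using that by (simp add: cyl nth_append)
  define T where "T w = trace_pos (R w)" for w
  have T_nonneg: "T w \<ge> 0" if "w \<in> words m n" for w n
    using that unfolding T_def by (intro trace_pos_nonneg R_tc) (simp add: words_def)
  \<comment> \<open>The expected trace at level \<open>n\<close>, written as a finite sum over
    words.\<close>
  define E where "E n = (\<Sum>w\<in>words m n. measure \<nu> (cylinder m w) * T w)" for n
  \<comment> \<open>The maximum keeps the ratio nonnegative: \<alpha> may exceed \<open>m\<close>
    when the closed range of the root of \<open>R0\<close> is trivial.\<close>
  define c where "c = max 0 (1 - \<alpha> / m)"
  have c: "0 \<le> c" "c < 1" using m \<alpha>_pos by (auto simp: c_def)
  have E_Suc: "E (Suc n) \<le> c * E n" for n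
  proof -
    have "E (Suc n) = (\<Sum>w\<in>words m n. measure \<nu> (cylinder m w) *
        (\<Sum>j\<in>{1..m}. p_tr m q R0 P w j * T (w @ [j])))"
      unfolding E_def sum_words_Suc sum_distrib_left
      by (intro sum.cong refl) (simp add: cyl_snoc words_def mult.assoc)
    also have "\<dots> \<le> (\<Sum>w\<in>words m n. measure \<nu> (cylinder m w) * (c * T w))"
    proof (intro sum_mono mult_left_mono)
      fix w assume w: "w \<in> words m n"
      then have "(\<Sum>j\<in>{1..m}. p_tr m q R0 P w j * T (w @ [j])) \<le> (1 - \<alpha> / m) * T w"
        unfolding T_def by (intro expected_trace_step m) (simp add: words_def)
      also have "\<dots> \<le> c * T w"
        using T_nonneg[OF w] by (intro mult_right_mono) (simp_all add: c_def)
      finally show "(\<Sum>j\<in>{1..m}. p_tr m q R0 P w j * T (w @ [j])) \<le> c * T w" .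
    qed simp
    also have "\<dots> = c * E n"
      unfolding E_def sum_distrib_left by (simp add: mult.left_commute)
    finally show ?thesis .
  qed
  have E_le: "E n \<le> c ^ n * E 0" for n
  proof (induction n)
    case (Suc n)
    have "E (Suc n) \<le> c * E n" by (rule E_Suc)
    also have "\<dots> \<le> c * (c ^ n * E 0)" using Suc c(1) by (rule mult_left_mono)
    finally show ?case by (simp add: mult.assoc)
  qed simp
  have E_nonneg: "E n \<ge> 0" for n
    unfolding E_def by (intro sum_nonneg mult_nonneg_nonneg measure_nonneg T_nonneg)
  have E_sm: "summable E"
    by (rule summable_comparison_test'[where N = 0 and g = "\<lambda>n. c ^ n * E 0"])
      (use c E_le E_nonneg in \<open>auto intro!: summable_mult2 summable_geometric\<close>)
  \<comment> \<open>A path lies in the cylinder of exactly one word of length \<open>n\<close>. The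
    trace along the path is thus a simple function, which settles both its measurability and its
    integral.\<close>
  have T_eq: "ennreal (T (prefix \<omega> n))
      = (\<Sum>w\<in>words m n. ennreal (T w) * indicator (cylinder m w) \<omega>)" if "\<omega> \<in> space \<nu>" for \<omega> n
  proof -
    have "indicator (cylinder m w) \<omega> = (if w = prefix \<omega> n then 1 else 0 :: ennreal)"
      if "w \<in> words m n" for w
      using that \<open>\<omega> \<in> space \<nu>\<close> by (auto simp: indicator_def cylinder_def words_def space)
    then have "(\<Sum>w\<in>words m n. ennreal (T w) * indicator (cylinder m w) \<omega>)
        = (\<Sum>w\<in>words m n. if w = prefix \<omega> n then ennreal (T w) else 0)"
      by (intro sum.cong refl) simp
    then show ?thesis
      using finite_words prefix_words that by (simp add: space)
  qed
  have T_meas: "(\<lambda>\<omega>. ennreal (T (prefix \<omega> n))) \<in> borel_measurable \<nu>" for n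
    by (subst measurable_cong[OF T_eq])
      (auto intro!: borel_measurable_sum borel_measurable_times_ennreal borel_measurable_indicator cyl_sets)
  have T_int: "(\<integral>\<^sup>+\<omega>. ennreal (T (prefix \<omega> n)) \<partial>\<nu>) = ennreal (E n)" for n
  proof -
    have "(\<integral>\<^sup>+\<omega>. ennreal (T (prefix \<omega> n)) \<partial>\<nu>)
        = (\<integral>\<^sup>+\<omega>. (\<Sum>w\<in>words m n. ennreal (T w) * indicator (cylinder m w) \<omega>) \<partial>\<nu>)"
      by (rule nn_integral_cong[OF T_eq])
    also have "\<dots> = (\<Sum>w\<in>words m n. ennreal (T w) * emeasure \<nu> (cylinder m w))"
      by (subst nn_integral_sum) (auto intro!: sum.cong nn_integral_cmult_indicator cyl_sets
          borel_measurable_times_ennreal borel_measurable_indicator)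
    also have "\<dots> = (\<Sum>w\<in>words m n. ennreal (measure \<nu> (cylinder m w) * T w))"
      by (intro sum.cong refl) (simp add: emeasure_eq_measure ennreal_mult' T_nonneg mult.commute)
    also have "\<dots> = ennreal (E n)"
      unfolding E_def by (intro sum_ennreal mult_nonneg_nonneg measure_nonneg T_nonneg)
    finally show ?thesis .
  qed
  \<comment> \<open>Sum and integral are interchanged in \<open>ennreal\<close>, so the geometric
    bound makes the sum of traces integrable and hence finite almost everywhere; its terms then tend
    to 0.\<close>
  have "(\<integral>\<^sup>+\<omega>. (\<Sum>n. ennreal (T (prefix \<omega> n))) \<partial>\<nu>) = (\<Sum>n. ennreal (E n))"
    by (subst nn_integral_suminf) (simp_all add: T_meas T_int)
  also have "\<dots> = ennreal (suminf E)"
    by (rule suminf_ennreal2[OF E_nonneg E_sm])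
  finally have "(\<integral>\<^sup>+\<omega>. (\<Sum>n. ennreal (T (prefix \<omega> n))) \<partial>\<nu>) \<noteq> \<infinity>" by simp
  moreover have "(\<lambda>\<omega>. \<Sum>n. ennreal (T (prefix \<omega> n))) \<in> borel_measurable \<nu>"
    using T_meas by measurable
  ultimately have "AE \<omega> in \<nu>. (\<Sum>n. ennreal (T (prefix \<omega> n))) \<noteq> \<infinity>"
    by (intro nn_integral_PInf_AE)
  then have "AE \<omega> in \<nu>. (\<lambda>n. T (prefix \<omega> n)) \<longlonglongrightarrow> 0"
  proof (rule AE_mp, intro AE_I2 impI)
    fix \<omega> assume \<omega>: "\<omega> \<in> space \<nu>" "(\<Sum>n. ennreal (T (prefix \<omega> n))) \<noteq> \<infinity>"
    have "summable (\<lambda>n. T (prefix \<omega> n))"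
    proof (rule summable_suminf_not_top)
      show "0 \<le> T (prefix \<omega> n)" for n
        using \<omega>(1) unfolding space by (rule T_nonneg[OF prefix_words])
      show "(\<Sum>n. ennreal (T (prefix \<omega> n))) \<noteq> \<top>" using \<omega>(2) by simp
    qed
    then show "(\<lambda>n. T (prefix \<omega> n)) \<longlonglongrightarrow> 0" by (rule summable_LIMSEQ_zero)
  qed
  then show ?thesis by (simp add: T_def)
qed

end

section \<open>Frames\<close>

text \<open>For finite \<open>F\<close> the operator \<open>B = A - \<Sum>\<^sub>i\<^sub>\<in>\<^sub>F \<langle>\<phi>\<^sub>i, \<cdot>\<rangle> \<phi>\<^sub>i\<close> satisfies \<open>0 \<le> B \<le> A\<close>, so that
  \<open>\<parallel>B x\<parallel>\<^sup>2\<close> is controlled by the tail of the scalar series.\<close>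
lemma frame_reconstruction:
  fixes \<phi> :: "'i \<Rightarrow> 'a::chilbert_space"
  assumes A: "positive_op A"
    and frame: "\<And>x. ((\<lambda>i. (cmod (cinner x (\<phi> i)))\<^sup>2) has_sum Re (cinner x (A x))) I"
  shows "((\<lambda>i. cinner (\<phi> i) x *\<^sub>C \<phi> i) has_sum A x) I"
proof -
  obtain M where M: "M > 0" "\<And>y. norm (A y) \<le> M * norm y"
    using positive_op_bound[OF A] by blast
  define S where "S F y = (\<Sum>i\<in>F. cinner (\<phi> i) y *\<^sub>C \<phi> i)" for F y
  have S_form: "Re (cinner y (S F y)) = (\<Sum>i\<in>F. (cmod (cinner y (\<phi> i)))\<^sup>2)" for F y
  proof -
    have "cinner (\<phi> i) y * cinner y (\<phi> i) = complex_of_real ((cmod (cinner y (\<phi> i)))\<^sup>2)" for i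
      using cinner_commute[of "\<phi> i" y] by (simp only: complex_norm_square mult.commute)
    then have "cinner y (S F y) = (\<Sum>i\<in>F. complex_of_real ((cmod (cinner y (\<phi> i)))\<^sup>2))"
      by (simp only: S_def cinner.sum_right cinner_scaleC_right)
    then show ?thesis by simp
  qed
  have bound: "(norm (A x - S F x))\<^sup>2
      \<le> M * (Re (cinner x (A x)) - (\<Sum>i\<in>F. (cmod (cinner x (\<phi> i)))\<^sup>2))"
    if F: "finite F" "F \<subseteq> I" for F
  proof -
    have "positive_op (\<lambda>y. A y - S F y)"
    proof (rule positive_opI)
      have "bounded_linear (\<lambda>y. cinner (\<phi> i) y *\<^sub>C \<phi> i)" for i
      proof (rule bounded_linear_intro)
        show "norm (cinner (\<phi> i) y *\<^sub>C \<phi> i) \<le> norm y * (norm (\<phi> i) * norm (\<phi> i))" for y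
          using mult_right_mono[OF cinner_Cauchy_Schwarz[of "\<phi> i" y] norm_ge_zero[of "\<phi> i"]]
          by (simp add: norm_scaleC mult_ac)
      qed (simp_all add: cinner.add_right scaleC_add_left cinner.scaleR_right scaleR_scaleC
          scaleC_scaleC cinner_scaleC_right)
      then show "bounded_linear (\<lambda>y. A y - S F y)"
        unfolding S_def
        by (intro bounded_linear_sub bounded_linear_sum positive_op_bounded_linear[OF A])
      show "A (c *\<^sub>C y) - S F (c *\<^sub>C y) = c *\<^sub>C (A y - S F y)" for c y
      proof -
        have lin: "linear (\<lambda>v::'a. c *\<^sub>C v)"
          by (rule bounded_linear.linear[OF bounded_linear_scaleC])
        have "S F (c *\<^sub>C y) = c *\<^sub>C S F y"
          unfolding S_def linear_sum[OF lin] by (simp add: cinner_scaleC_right scaleC_scaleC)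
        then show ?thesis
          using linear_diff[OF lin, of "A y" "S F y"] by (simp add: positive_op_scaleC[OF A])
      qed
      show "cinner (A y - S F y) z = cinner y (A z - S F z)" for y z
      proof -
        have "cinner (cinner (\<phi> i) y *\<^sub>C \<phi> i) z = cinner y (cinner (\<phi> i) z *\<^sub>C \<phi> i)" for i
          using cinner_commute[of y "\<phi> i"]
          by (simp add: cinner_scaleC_left cinner_scaleC_right mult.commute)
        then show ?thesis
          by (simp add: S_def cinner.diff_left cinner.diff_right cinner.sum_left cinner.sum_right
              positive_op_selfadjoint[OF A])
      qed
      show "0 \<le> Re (cinner y (A y - S F y))" for y
        using finite_sum_le_has_sum[OF frame F] by (simp add: cinner.diff_right S_form)
    qed
    moreover have "Re (cinner y (A y - S F y)) \<le> Re (cinner y (A y))" for y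
      by (simp add: cinner.diff_right S_form sum_nonneg)
    ultimately have "(norm (A x - S F x))\<^sup>2 \<le> M * Re (cinner x (A x - S F x))"
      using positive_op_norm_le_form[of "\<lambda>y. A y - S F y" A M x] M by blast
    then show ?thesis by (simp only: cinner.diff_right minus_complex.sel S_form)
  qed
  have "((\<lambda>F. M * (Re (cinner x (A x)) - (\<Sum>i\<in>F. (cmod (cinner x (\<phi> i)))\<^sup>2)))
      \<longlongrightarrow> M * (Re (cinner x (A x)) - Re (cinner x (A x)))) (finite_subsets_at_top I)"
    using frame[of x] unfolding has_sum_def
    by (intro tendsto_mult tendsto_diff tendsto_const)
  then have "((\<lambda>F. M * (Re (cinner x (A x)) - (\<Sum>i\<in>F. (cmod (cinner x (\<phi> i)))\<^sup>2))) \<longlongrightarrow> 0)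
      (finite_subsets_at_top I)"
    by simp
  then have "((\<lambda>F. (norm (A x - S F x))\<^sup>2) \<longlongrightarrow> 0) (finite_subsets_at_top I)"
    by (rule Lim_null_comparison[rotated])
      (auto intro!: eventually_finite_subsets_at_top_weakI bound)
  then have "((\<lambda>F. sqrt ((norm (A x - S F x))\<^sup>2)) \<longlongrightarrow> sqrt 0) (finite_subsets_at_top I)"
    by (rule tendsto_real_sqrt)
  then have "((\<lambda>F. norm (A x - S F x)) \<longlongrightarrow> 0) (finite_subsets_at_top I)" by simp
  then have "((\<lambda>F. S F x) \<longlongrightarrow> A x) (finite_subsets_at_top I)"
    unfolding tendsto_iff by (simp add: dist_norm norm_minus_commute)
  then show ?thesis unfolding has_sum_def S_def .
qed

section \<open>Closed spans and spectral vectors\<close>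

lemma scaleC_sum_left: "(\<Sum>i\<in>F. c i) *\<^sub>C (v::'a::complex_vector) = (\<Sum>i\<in>F. c i *\<^sub>C v)"
proof -
  have "0 *\<^sub>C v = 0" using scaleC_add_left[of 0 0 v] by simp
  then show ?thesis
    by (induction F rule: infinite_finite_induct) (simp_all add: scaleC_add_left)
qed

text \<open>\<open>cspan\<close> sums over a set of vectors, whereas \<open>\<phi>\<close> may
  repeat values; coefficients of equal vectors are collected first.\<close>

lemma sum_in_cspan:
  assumes "finite F" "F \<subseteq> I"
  shows "(\<Sum>i\<in>F. c i *\<^sub>C \<phi> i) \<in> cspan (\<phi> ` I)"
proof -
  have "(\<Sum>i\<in>F. c i *\<^sub>C \<phi> i) = (\<Sum>v\<in>\<phi> ` F. \<Sum>i\<in>{i\<in>F. \<phi> i = v}. c i *\<^sub>C \<phi> i)"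
    by (rule sum.image_gen[OF assms(1)])
  also have "\<dots> = (\<Sum>v\<in>\<phi> ` F. (\<Sum>i\<in>{i\<in>F. \<phi> i = v}. c i) *\<^sub>C v)"
    by (intro sum.cong refl) (simp add: scaleC_sum_left)
  finally have "(\<Sum>i\<in>F. c i *\<^sub>C \<phi> i) = (\<Sum>v\<in>\<phi> ` F. (\<Sum>i\<in>{i\<in>F. \<phi> i = v}. c i) *\<^sub>C v)" .
  moreover have "finite (\<phi> ` F)" "\<phi> ` F \<subseteq> \<phi> ` I" using assms by auto
  ultimately show ?thesis
    unfolding cspan_def mem_Collect_eq by (intro exI conjI)
qed

lemma has_sum_in_closure_cspan:
  fixes \<phi> :: "'i \<Rightarrow> 'a::complex_inner"
  assumes "((\<lambda>i. c i *\<^sub>C \<phi> i) has_sum y) I"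
  shows "y \<in> closure (cspan (\<phi> ` I))"
  unfolding closure_approachable
proof (intro allI impI)
  fix \<epsilon> :: real assume "\<epsilon> > 0"
  then obtain F where F: "finite F" "F \<subseteq> I" "dist (\<Sum>i\<in>F. c i *\<^sub>C \<phi> i) y \<le> \<epsilon> / 2"
    using has_sum_finite_approximation[OF assms, of "\<epsilon> / 2"] by auto
  have "dist (\<Sum>i\<in>F. c i *\<^sub>C \<phi> i) y < \<epsilon>" using F(3) \<open>\<epsilon> > 0\<close> by simp
  then show "\<exists>z\<in>cspan (\<phi> ` I). dist z y < \<epsilon>"
    using sum_in_cspan[OF F(1,2)] by (intro bexI)
qed

text \<open>The range of \<open>S\<close> is a complex subspace, and limits of sequences carry
  addition and scaling over to its closure.\<close>

lemma cspan_subset_closure_range: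
  assumes S: "positive_op S" and \<Phi>: "\<Phi> \<subseteq> closure (range S)"
  shows "cspan \<Phi> \<subseteq> closure (range S)"
proof
  interpret bounded_linear S using S by (rule positive_op_bounded_linear)
  have add_closed: "x + y \<in> closure (range S)"
    if x: "x \<in> closure (range S)" and y: "y \<in> closure (range S)" for x y
  proof -
    obtain f where f: "\<And>n. f n \<in> range S" "f \<longlonglongrightarrow> x" using x unfolding closure_sequential by blast
    obtain g where g: "\<And>n. g n \<in> range S" "g \<longlonglongrightarrow> y" using y unfolding closure_sequential by blast
    have "f n + g n \<in> range S" for n
      using f(1)[of n] g(1)[of n] by (auto simp: add[symmetric])
    moreover have "(\<lambda>n. f n + g n) \<longlonglongrightarrow> x + y" by (intro tendsto_add f g)
    ultimately show ?thesis
      unfolding closure_sequential by (intro exI[of _ "\<lambda>n. f n + g n"]) simp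
  qed
  have scale_closed: "c *\<^sub>C x \<in> closure (range S)" if x: "x \<in> closure (range S)" for c x
  proof -
    obtain f where f: "\<And>n. f n \<in> range S" "f \<longlonglongrightarrow> x" using x unfolding closure_sequential by blast
    have "c *\<^sub>C f n \<in> range S" for n
      using f(1)[of n] by (auto simp: positive_op_scaleC[OF S, symmetric])
    moreover have "(\<lambda>n. c *\<^sub>C f n) \<longlonglongrightarrow> c *\<^sub>C x"
      by (rule bounded_linear.tendsto[OF bounded_linear_scaleC f(2)])
    ultimately show ?thesis
      unfolding closure_sequential by (intro exI[of _ "\<lambda>n. c *\<^sub>C f n"]) simp
  qed
  fix x assume "x \<in> cspan \<Phi>"
  then obtain F c where F: "finite F" "F \<subseteq> \<Phi>" "x = (\<Sum>v\<in>F. c v *\<^sub>C v)"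
    unfolding cspan_def by blast
  have "(\<Sum>v\<in>F. c v *\<^sub>C v) \<in> closure (range S)"
    using F(1,2)
  proof (induction F)
    case empty
    have "S 0 \<in> closure (range S)" by (rule closure_subset[THEN subsetD, OF rangeI])
    then show ?case by (simp add: zero)
  next
    case (insert v F)
    then have "v \<in> closure (range S)" using \<Phi> by auto
    then show ?case using insert by (simp add: add_closed scale_closed)
  qed
  then show "x \<in> closure (range S)" by (simp only: F(3))
qed

text \<open>The continuous functional \<open><x, .>\<close> is applied termwise; since
  \<open>lam r\<close> is nonnegative, its square root moves into the vector on both sides.\<close>

lemma spectral_form_has_sum:
  fixes u :: "'r \<Rightarrow> 'a::complex_inner"
  assumes nonneg: "\<And>r. r \<in> I \<Longrightarrow> lam r \<ge> 0"
    and sum: "((\<lambda>r. complex_of_real (lam r) *\<^sub>C cinner (u r) x *\<^sub>C u r) has_sum y) I"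
  shows "((\<lambda>r. complex_of_real ((cmod (cinner x (complex_of_real (sqrt (lam r)) *\<^sub>C u r)))\<^sup>2))
    has_sum cinner x y) I"
proof -
  have "((\<lambda>r. cinner x (complex_of_real (lam r) *\<^sub>C cinner (u r) x *\<^sub>C u r)) has_sum cinner x y) I"
    by (rule has_sum_bounded_linear[OF cinner.bounded_linear_right sum])
  moreover have "cinner x (complex_of_real (lam r) *\<^sub>C cinner (u r) x *\<^sub>C u r)
      = complex_of_real ((cmod (cinner x (complex_of_real (sqrt (lam r)) *\<^sub>C u r)))\<^sup>2)"
    if "r \<in> I" for r
  proof -
    have "cinner (u r) x * cinner x (u r) = complex_of_real ((cmod (cinner x (u r)))\<^sup>2)"
      using cinner_commute[of "u r" x] by (simp only: complex_norm_square mult.commute)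
    then show ?thesis
      using nonneg[OF that]
      by (simp add: cinner_scaleC_right norm_mult power_mult_distrib flip: of_real_power)
  qed
  ultimately show ?thesis by (simp cong: has_sum_cong)
qed

text \<open>Orthonormality collapses the series at \<open>u r\<close> to one term, so
  \<open>u r\<close> is an eigenvector for \<open>lam r\<close>, and \<open>A\<close> maps
  \<open>u r / sqrt (lam r)\<close> to the required vector.\<close>

lemma spectral_vector_in_range:
  fixes u :: "'r \<Rightarrow> 'a::complex_inner"
  assumes on: "orthonormal (u ` I)" "inj_on u I" and r: "r \<in> I" "lam r \<ge> 0"
    and sum: "\<And>x. ((\<lambda>r. complex_of_real (lam r) *\<^sub>C cinner (u r) x *\<^sub>C u r) has_sum A x) I"
    and scale: "\<And>c x. A (c *\<^sub>C x) = c *\<^sub>C A x"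
  shows "complex_of_real (sqrt (lam r)) *\<^sub>C u r \<in> range A"
proof -
  have zero: "0 *\<^sub>C v = 0" "c *\<^sub>C (0::'a) = 0" for c and v :: 'a
    using scaleC_add_left[of 0 0 v] scaleC_add_right[of c 0 "0::'a"] by simp_all
  have "cinner (u s) (u r) = (if s = r then 1 else 0)" if "s \<in> I" for s
  proof -
    have "u s = u r \<longleftrightarrow> s = r" using on(2) r(1) that by (simp add: inj_on_eq_iff)
    then show ?thesis using on(1) r(1) that by (auto simp: orthonormal_def cinner_self)
  qed
  then have "((\<lambda>s. complex_of_real (lam s) *\<^sub>C cinner (u s) (u r) *\<^sub>C u s)
      has_sum complex_of_real (lam r) *\<^sub>C u r) I"
    using r(1) by (intro has_sum_finite_neutralI[of "{r}"]) (auto simp: zero scaleC_one)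
  with sum[of "u r"] have eig: "A (u r) = complex_of_real (lam r) *\<^sub>C u r"
    by (rule has_sum_unique)
  have "A (complex_of_real (1 / sqrt (lam r)) *\<^sub>C u r)
      = complex_of_real (1 / sqrt (lam r) * lam r) *\<^sub>C u r"
    by (simp only: scale eig scaleC_scaleC of_real_mult)
  \<comment> \<open>For \<open>lam r = 0\<close> both sides are 0, because division by zero yields
    0.\<close>
  also have "1 / sqrt (lam r) * lam r = sqrt (lam r)"
    using r(2) by (simp add: real_div_sqrt)
  finally show ?thesis by (rule range_eqI[OF sym])
qed

section \<open>Expansion of \<open>R0\<close> along a fixed path\<close>

context energy_tree
begin

context
  fixes \<omega> assumes \<omega>: "\<omega> \<in> space (Omega_space m)"
begin

lemma prefix_set: "set (prefix \<omega> n) \<subseteq> {1..m}"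
  using prefix_words[OF \<omega>] by (simp add: words_def)

lemma Delta_pos: "k \<ge> 1 \<Longrightarrow> positive_op (Delta R0 P \<omega> k)"
  unfolding Delta_def by (rule D_pos[OF prefix_set]) (use \<omega> in \<open>simp only: space_Omega_space\<close>)

lemma range_Delta: "range (Delta R0 P \<omega> k) \<subseteq> closure (range (op_sqrt R0))"
  using range_sqrt_R[OF prefix_set] by (auto simp: Delta_def Dw_def)

text \<open>\<open>Delta\<close> at index \<open>Suc n\<close> is built on the prefix of length
  \<open>n\<close>, so each summand is one splitting of the current remainder.\<close>

lemma sum_Delta: "(\<Sum>k\<in>{1..n}. Delta R0 P \<omega> k x) = R0 x - R (prefix \<omega> n) x"
proof (induction n)
  case 0
  show ?case by (simp add: prefix_def R_Nil)
next
  case (Suc n)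
  then show ?case
    using R_split[OF prefix_set, of n x "\<omega> n"] by (simp add: Delta_def prefix_Suc)
qed

text \<open>All remainders lie below \<open>R0\<close>, so one norm bound \<open>M\<close> serves
  every \<open>n\<close>: \<open>(norm (R_n x))^2\<close> is at most \<open>M <x, R_n x>\<close>,
  hence at most \<open>M (tr R_n) (norm x)^2\<close>.\<close>

lemma R_prefix_tendsto_0:
  assumes "(\<lambda>n. trace_pos (R (prefix \<omega> n))) \<longlonglongrightarrow> 0"
  shows "(\<lambda>n. R (prefix \<omega> n) x) \<longlonglongrightarrow> 0"
proof -
  obtain M where M: "M > 0" "\<And>y. norm (R0 y) \<le> M * norm y"
    using positive_op_bound[OF R0_pos] by blast
  have bound: "(norm (R (prefix \<omega> n) x))\<^sup>2 \<le> M * (trace_pos (R (prefix \<omega> n)) * (norm x)\<^sup>2)" for n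
  proof -
    have "(norm (R (prefix \<omega> n) x))\<^sup>2 \<le> M * Re (cinner x (R (prefix \<omega> n) x))"
      by (rule positive_op_norm_le_form[OF R_pos[OF prefix_set] R_le_R0[OF prefix_set] M])
    also have "\<dots> \<le> M * (trace_pos (R (prefix \<omega> n)) * (norm x)\<^sup>2)"
      using M(1) form_le_trace_pos[OF R_tc[OF prefix_set]] by simp
    finally show ?thesis .
  qed
  have "(\<lambda>n. M * (trace_pos (R (prefix \<omega> n)) * (norm x)\<^sup>2)) \<longlonglongrightarrow> M * (0 * (norm x)\<^sup>2)"
    by (intro tendsto_mult tendsto_const assms)
  then have "(\<lambda>n. M * (trace_pos (R (prefix \<omega> n)) * (norm x)\<^sup>2)) \<longlonglongrightarrow> 0" by simp
  then have "(\<lambda>n. (norm (R (prefix \<omega> n) x))\<^sup>2) \<longlonglongrightarrow> 0"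
    by (rule Lim_null_comparison[rotated]) (simp add: bound)
  then have "(\<lambda>n. sqrt ((norm (R (prefix \<omega> n) x))\<^sup>2)) \<longlonglongrightarrow> sqrt 0" by (rule tendsto_real_sqrt)
  then have "(\<lambda>n. norm (R (prefix \<omega> n) x)) \<longlonglongrightarrow> 0" by simp
  then show ?thesis by (rule tendsto_norm_zero_cancel)
qed

lemma sum_Delta_tendsto:
  assumes "(\<lambda>n. trace_pos (R (prefix \<omega> n))) \<longlonglongrightarrow> 0"
  shows "(\<lambda>n. \<Sum>k\<in>{1..n}. Delta R0 P \<omega> k x) \<longlonglongrightarrow> R0 x"
proof -
  have "(\<lambda>n. R0 x - R (prefix \<omega> n) x) \<longlonglongrightarrow> R0 x - 0"
    by (intro tendsto_diff tendsto_const R_prefix_tendsto_0 assms)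
  then show ?thesis unfolding sum_Delta by simp
qed

text \<open>Nonnegativity turns the ordered limit into an unordered sum, the form needed to merge it
  with the inner sums over \<open>r\<close>.\<close>

lemma Delta_form_has_sum:
  assumes "(\<lambda>n. trace_pos (R (prefix \<omega> n))) \<longlonglongrightarrow> 0"
  shows "((\<lambda>k. Re (cinner x (Delta R0 P \<omega> k x))) has_sum Re (cinner x (R0 x))) {1..}"
proof -
  have "(\<lambda>n. Re (cinner x (\<Sum>k\<in>{1..n}. Delta R0 P \<omega> k x))) \<longlonglongrightarrow> Re (cinner x (R0 x))"
    by (intro tendsto_Re cinner.tendsto tendsto_const sum_Delta_tendsto assms)
  moreover have "(\<Sum>k\<in>{1..n}. Re (cinner x (Delta R0 P \<omega> k x)))
      = (\<Sum>k<n. Re (cinner x (Delta R0 P \<omega> (Suc k) x)))" for n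
    by (rule sum.reindex_bij_witness[of _ Suc "\<lambda>k. k - 1"]) auto
  ultimately have "(\<lambda>k. Re (cinner x (Delta R0 P \<omega> (Suc k) x))) sums Re (cinner x (R0 x))"
    by (simp add: sums_def cinner.sum_right)
  then have "((\<lambda>k. Re (cinner x (Delta R0 P \<omega> (Suc k) x))) has_sum Re (cinner x (R0 x))) UNIV"
    by (rule sums_nonneg_imp_has_sum) (simp add: positive_op_nonneg Delta_pos)
  moreover have "bij_betw Suc UNIV {1..}"
    by (rule bij_betwI[where g = "\<lambda>k. k - 1"]) auto
  ultimately show ?thesis
    using has_sum_reindex_bij_betw[of Suc UNIV "{1..}"] by blast
qed

end

end

section \<open>Frame expansion of \<open>R0\<close> along almost every path\<close>

theorem theorem7p3:
  fixes m :: nat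
    and P :: "nat \<Rightarrow> 'a::chilbert_space \<Rightarrow> 'a"
    and R0 :: "'a \<Rightarrow> 'a"
    and q :: "nat \<Rightarrow> real"
    and \<nu> :: "(nat \<Rightarrow> nat) measure"
    and Rset :: "(nat \<Rightarrow> nat) \<Rightarrow> nat \<Rightarrow> 'r set"
    and u :: "(nat \<Rightarrow> nat) \<Rightarrow> nat \<Rightarrow> 'r \<Rightarrow> 'a"
    and lam :: "(nat \<Rightarrow> nat) \<Rightarrow> nat \<Rightarrow> 'r \<Rightarrow> real"
  assumes separable: "\<exists>D::'a set. countable D \<and> closure D = UNIV"
    and m: "m \<ge> 2"
    and proj: "\<forall>j\<in>{1..m}. orth_proj (P j)"
    and R0_pos: "positive_op R0"
    and leakage: "\<exists>\<alpha>>0. \<forall>v\<in>closure (range (op_sqrt R0)).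
                     Re (cinner v (\<Sum>j\<in>{1..m}. P j v)) \<ge> \<alpha> * (norm v)\<^sup>2"
    and R0_tc: "trace_class_pos R0"
    and q: "\<forall>j\<in>{1..m}. 0 < q j \<and> q j < 1" "(\<Sum>j\<in>{1..m}. q j) = 1"
    and nu: "is_nu_tr m q R0 P \<nu>"
    and decomp: "\<forall>\<omega>\<in>space (Omega_space m). \<forall>k\<ge>1.
        countable (Rset \<omega> k) \<and> orthonormal (u \<omega> k ` Rset \<omega> k) \<and> inj_on (u \<omega> k) (Rset \<omega> k) \<and>
        (\<forall>r\<in>Rset \<omega> k. lam \<omega> k r \<ge> 0) \<and>
        (\<forall>x. ((\<lambda>r. complex_of_real (lam \<omega> k r) *\<^sub>C cinner (u \<omega> k r) x *\<^sub>C u \<omega> k r)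
                 has_sum Delta R0 P \<omega> k x) (Rset \<omega> k))"
  shows "\<exists>\<Omega>0. \<Omega>0 \<subseteq> space (Omega_space m) \<and> \<Omega>0 \<in> sets \<nu> \<and> measure \<nu> \<Omega>0 = 1 \<and>
    (\<forall>\<omega>\<in>\<Omega>0.
      let \<phi> = (\<lambda>k r. complex_of_real (sqrt (lam \<omega> k r)) *\<^sub>C u \<omega> k r);
          \<Phi> = {\<phi> k r | k r. k \<ge> 1 \<and> r \<in> Rset \<omega> k}
      in
      \<comment> \<open>(1)\<close>
      (\<forall>x. (\<lambda>n. \<Sum>k\<in>{1..n}. Delta R0 P \<omega> k x) \<longlonglongrightarrow> R0 x) \<and>
      \<comment> \<open>(2)\<close>
      (\<forall>x. (\<lambda>n. \<Sum>k\<in>{1..n}. cinner x (Delta R0 P \<omega> k x)) \<longlonglongrightarrow> cinner x (R0 x) \<and>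
           incseq (\<lambda>n. \<Sum>k\<in>{1..n}. Re (cinner x (Delta R0 P \<omega> k x))) \<and>
           (\<forall>k\<ge>1. ((\<lambda>r. complex_of_real ((cmod (cinner x (\<phi> k r)))\<^sup>2))
                      has_sum cinner x (Delta R0 P \<omega> k x)) (Rset \<omega> k))) \<and>
      \<comment> \<open>(3)\<close>
      closure (cspan \<Phi>) = closure (range (op_sqrt R0)) \<and>
      (\<forall>x. ((\<lambda>(k, r). complex_of_real ((cmod (cinner x (\<phi> k r)))\<^sup>2))
              has_sum cinner x (R0 x)) (SIGMA k:{1..}. Rset \<omega> k)) \<and>
      (\<forall>x. ((\<lambda>(k, r). cinner (\<phi> k r) x *\<^sub>C \<phi> k r) has_sum R0 x) (SIGMA k:{1..}. Rset \<omega> k)) \<and>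
      \<comment> \<open>in particular: Parseval frame when \<open>R0\<close> is an orthogonal projection onto \<open>K\<close>\<close>
      (orth_proj R0 \<longrightarrow>
         closure (cspan \<Phi>) = range R0 \<and>
         (\<forall>x\<in>range R0. ((\<lambda>(k, r). (cmod (cinner x (\<phi> k r)))\<^sup>2) has_sum (norm x)\<^sup>2)
                            (SIGMA k:{1..}. Rset \<omega> k))))"
proof -
  obtain \<alpha> where \<alpha>: "\<alpha> > 0" "\<And>v. v \<in> closure (range (op_sqrt R0)) \<Longrightarrow>
      \<alpha> * (norm v)\<^sup>2 \<le> Re (cinner v (\<Sum>j\<in>{1..m}. P j v))"
    using leakage by blast
  interpret energy_tree m P R0 \<alpha>
    by unfold_locales (use proj R0_tc \<alpha> in auto)
  interpret prob_space \<nu> using nu by (simp add: is_nu_tr_def)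
  have space: "space \<nu> = space (Omega_space m)"
    using nu by (intro sets_eq_imp_space_eq) (simp add: is_nu_tr_def)
  have "AE \<omega> in \<nu>. (\<lambda>n. trace_pos (R (prefix \<omega> n))) \<longlonglongrightarrow> 0"
    using nu m by (intro AE_trace_tendsto_0) auto
  then obtain N where N: "N \<in> null_sets \<nu>"
    "\<And>\<omega>. \<omega> \<in> space \<nu> - N \<Longrightarrow> (\<lambda>n. trace_pos (R (prefix \<omega> n))) \<longlonglongrightarrow> 0"
    by (rule AE_E3) blast
  have N_sets: "N \<in> sets \<nu>" using N(1) by auto
  have "measure \<nu> N = 0" using N(1) by (simp add: measure_def null_setsD1)
  then have meas: "measure \<nu> (space \<nu> - N) = 1" using prob_compl[OF N_sets] by simp
  show ?thesis
  \<comment> \<open>The exceptional null set depends only on the traces, so one set of paths serves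
    all \<open>x\<close> and every choice of spectral vectors.\<close>
  proof (intro exI[of _ "space \<nu> - N"] conjI ballI, goal_cases)
    case 1
    show ?case by (auto simp: space)
  next
    case 2
    show ?case using N_sets by auto
  next
    case 3
    show ?case by (rule meas)
  next
    case (4 \<omega>)
    then have \<omega>: "\<omega> \<in> space (Omega_space m)" and lim: "(\<lambda>n. trace_pos (R (prefix \<omega> n))) \<longlonglongrightarrow> 0"
      using N(2) by (auto simp: space)
    define \<phi> where "\<phi> = (\<lambda>k r. complex_of_real (sqrt (lam \<omega> k r)) *\<^sub>C u \<omega> k r)"
    define I where "I = (SIGMA k:{1..}. Rset \<omega> k)"
    \<comment> \<open>Flattens the double index, so that the single-index frame lemmas
      apply.\<close>
    define \<psi> where "\<psi> = (\<lambda>(k, r). \<phi> k r)"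
    have \<Phi>: "{\<phi> k r | k r. k \<ge> 1 \<and> r \<in> Rset \<omega> k} = \<psi> ` I"
      by (force simp: \<psi>_def I_def)
    have dec: "orthonormal (u \<omega> k ` Rset \<omega> k)" "inj_on (u \<omega> k) (Rset \<omega> k)"
      "\<And>r. r \<in> Rset \<omega> k \<Longrightarrow> lam \<omega> k r \<ge> 0"
      "\<And>x. ((\<lambda>r. complex_of_real (lam \<omega> k r) *\<^sub>C cinner (u \<omega> k r) x *\<^sub>C u \<omega> k r)
                 has_sum Delta R0 P \<omega> k x) (Rset \<omega> k)" if "k \<ge> 1" for k
      using decomp \<omega> that by blast+
    have form: "((\<lambda>r. complex_of_real ((cmod (cinner x (\<phi> k r)))\<^sup>2))
        has_sum cinner x (Delta R0 P \<omega> k x)) (Rset \<omega> k)" if k: "k \<ge> 1" for k x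
      unfolding \<phi>_def by (rule spectral_form_has_sum[OF dec(3)[OF k] dec(4)[OF k]])
    have form_Re: "((\<lambda>r. (cmod (cinner x (\<psi> (k, r))))\<^sup>2)
        has_sum Re (cinner x (Delta R0 P \<omega> k x))) (Rset \<omega> k)" if k: "k \<in> {1..}" for k x
      using has_sum_Re[OF form[of k x]] k by (simp add: \<psi>_def)
    \<comment> \<open>The inner spectral sums and the outer sum over \<open>k\<close> have
      nonnegative terms, so they combine into one unordered sum over pairs.\<close>
    have frame: "((\<lambda>i. (cmod (cinner x (\<psi> i)))\<^sup>2) has_sum Re (cinner x (R0 x))) I" for x
      unfolding I_def
    proof (rule has_sum_SigmaI[OF form_Re Delta_form_has_sum[OF \<omega> lim]])
      show "(\<lambda>i. (cmod (cinner x (\<psi> i)))\<^sup>2) summable_on (SIGMA k:{1..}. Rset \<omega> k)"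
        by (rule summable_on_SigmaI[OF form_Re
              has_sum_imp_summable[OF Delta_form_has_sum[OF \<omega> lim]]]) simp_all
    qed
    have case_\<psi>: "(\<lambda>(k, r). f (\<phi> k r)) = (\<lambda>i. f (\<psi> i))" for f :: "'a \<Rightarrow> 'b"
      by (simp add: \<psi>_def fun_eq_iff)
    have frame_complex: "((\<lambda>(k, r). complex_of_real ((cmod (cinner x (\<phi> k r)))\<^sup>2))
        has_sum cinner x (R0 x)) I" for x
      using has_sum_of_real[OF frame[of x], where 'a = complex]
      by (simp only: case_\<psi>[of "\<lambda>v. complex_of_real ((cmod (cinner x v))\<^sup>2)"]
          positive_op_real[OF R0_pos, symmetric])
    have recon: "((\<lambda>i. cinner (\<psi> i) x *\<^sub>C \<psi> i) has_sum R0 x) I" for x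
      by (rule frame_reconstruction[OF R0_pos frame])
    have "closure (cspan (\<psi> ` I)) \<subseteq> closure (range (op_sqrt R0))"
    proof (intro closure_minimal cspan_subset_closure_range op_sqrt_positive R0_pos closed_closure)
      show "\<psi> ` I \<subseteq> closure (range (op_sqrt R0))"
      proof clarify
        fix k r assume "(k, r) \<in> I"
        then have k: "k \<ge> 1" and r: "r \<in> Rset \<omega> k" by (auto simp: I_def)
        have "\<phi> k r \<in> range (Delta R0 P \<omega> k)"
          unfolding \<phi>_def
          by (rule spectral_vector_in_range[OF dec(1,2)[OF k] r dec(3)[OF k r] dec(4)[OF k]
                positive_op_scaleC[OF Delta_pos[OF \<omega> k]]])
        then show "\<psi> (k, r) \<in> closure (range (op_sqrt R0))"
          using range_Delta[OF \<omega>] by (auto simp: \<psi>_def)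
      qed
    qed
    \<comment> \<open>Reconstruction places the range of \<open>R0\<close> in the closed span, and
      the range of the root lies in the closure of the range of \<open>R0\<close>.\<close>
    moreover have "closure (range (op_sqrt R0)) \<subseteq> closure (cspan (\<psi> ` I))"
    proof -
      have "range R0 \<subseteq> closure (cspan (\<psi> ` I))"
        using has_sum_in_closure_cspan[OF recon] by blast
      then have "closure (range R0) \<subseteq> closure (cspan (\<psi> ` I))"
        by (intro closure_minimal closed_closure)
      with range_op_sqrt_subset_closure_range[OF R0_pos] show ?thesis
        by (intro closure_minimal closed_closure) (rule subset_trans)
    qed
    ultimately have span: "closure (cspan (\<psi> ` I)) = closure (range (op_sqrt R0))" ..
    have mono: "incseq (\<lambda>n. \<Sum>k\<in>{1..n}. Re (cinner x (Delta R0 P \<omega> k x)))" for x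
      by (rule incseq_SucI) (simp add: positive_op_nonneg Delta_pos[OF \<omega>])
    have form_lim: "(\<lambda>n. \<Sum>k\<in>{1..n}. cinner x (Delta R0 P \<omega> k x)) \<longlonglongrightarrow> cinner x (R0 x)" for x
      unfolding cinner.sum_right[symmetric]
      by (intro cinner.tendsto tendsto_const sum_Delta_tendsto[OF \<omega> lim])
    have parseval: "closure (cspan (\<psi> ` I)) = range R0 \<and>
        (\<forall>x\<in>range R0. ((\<lambda>(k, r). (cmod (cinner x (\<phi> k r)))\<^sup>2) has_sum (norm x)\<^sup>2) I)"
      if proj_R0: "orth_proj R0"
    proof
      have idem: "R0 (R0 x) = R0 x" for x using proj_R0 by (simp add: orth_proj_def)
      interpret R0: bounded_linear R0 by (rule positive_op_bounded_linear[OF R0_pos])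
      \<comment> \<open>The range of an idempotent is its set of fixed points, which is closed by
        continuity.\<close>
      have "closure (range R0) = range R0"
      proof (intro equalityI closure_subset subsetI)
        fix x assume "x \<in> closure (range R0)"
        then obtain f where f: "\<And>n. f n \<in> range R0" "f \<longlonglongrightarrow> x"
          unfolding closure_sequential by blast
        have "R0 (f n) = f n" for n using f(1)[of n] idem by auto
        then have "f \<longlonglongrightarrow> R0 x" using R0.tendsto[OF f(2)] by simp
        with f(2) have "x = R0 x" by (rule LIMSEQ_unique)
        then show "x \<in> range R0" by (rule range_eqI)
      qed
      then show "closure (cspan (\<psi> ` I)) = range R0"
        by (simp only: span op_sqrt_orth_proj(2)[OF proj_R0])
      show "\<forall>x\<in>range R0. ((\<lambda>(k, r). (cmod (cinner x (\<phi> k r)))\<^sup>2) has_sum (norm x)\<^sup>2) I"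
      proof
        fix x assume "x \<in> range R0"
        then have "R0 x = x" using idem by auto
        then show "((\<lambda>(k, r). (cmod (cinner x (\<phi> k r)))\<^sup>2) has_sum (norm x)\<^sup>2) I"
          using frame[of x] by (simp only: case_\<psi>[of "\<lambda>v. (cmod (cinner x v))\<^sup>2"] Re_cinner_self)
      qed
    qed
    have recon': "((\<lambda>(k, r). cinner (\<phi> k r) x *\<^sub>C \<phi> k r) has_sum R0 x) I" for x
      using recon[of x] by (simp only: case_\<psi>[of "\<lambda>v. cinner v x *\<^sub>C v"])
    have \<phi>_fold: "complex_of_real (sqrt (lam \<omega> k r)) *\<^sub>C u \<omega> k r = \<phi> k r" for k r
      by (simp only: \<phi>_def)
    show ?case
      unfolding Let_def \<phi>_fold \<Phi> I_def[symmetric]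
      using sum_Delta_tendsto[OF \<omega> lim] form_lim mono form span frame_complex recon' parseval
      by blast
  qed
qed

end
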